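(* Let $\mathfrak N^{\mathrm{semidet}}$ be the set of all 2-user semi-deterministic discrete memoryless broadcast channels, and for $\mathcal N\in\mathfrak N^{\mathrm{semidet}}$ let $C_\Sigma^{\mathrm{NS}}(\mathcal N)$ and $C_\Sigma(\mathcal N)$ be its sum-capacity with and without NS-assistance. Then $$\sup_{\mathcal N\in\mathfrak N^{\mathrm{semidet}}}\frac{C_\Sigma^{\mathrm{NS}}(\mathcal N)}{C_\Sigma(\mathcal N)}=2.$$
   Context: A 2-user BC $(\mathcal X,\mathcal Y_1,\mathcal Y_2,\mathcal N_{Y_1Y_2\mid X})$ is semi-deterministic if for some $k\in\{1,2\}$ the marginal $\mathcal N_{Y_k\mid X}(y_k\mid x)\in\{0,1\}$ for all $x,y_k$. Coding framework: messages $W_1,W_2$ independent and uniform on finite sets $\mathcal M_1,\mathcal M_2$. Classical scheme: stochastic encoder $X^{[n]}=\phi(W_1,W_2)$, stochastic decoders $\hat W_k=\psi_k(Y_k^{[n]})$. A $\kappa$-partite NS box is a conditional pmf $\mathcal Z(b_1,\dots,b_\kappa\mid a_1,\dots,a_\kappa)$ (finite output alphabets) such that for every subset of parties the marginal of their outputs depends only on their own inputs. NS-assisted scheme: a 3-partite NS box where the transmitter inputs $(W_1,W_2)$ and obtains $U\in\mathcal X^n$, sent as $X^{[n]}=U$; Rx-$k$ inputs $Y_k^{[n]}$ and obtains $\hat W_k$; joint law $\frac{1}{|\mathcal M_1||\mathcal M_2|}\mathcal Z(x^{[n]},\hat w_1,\hat w_2\mid w_1,w_2,y_1^{[n]},y_2^{[n]})\mathcal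 N^{\otimes n}(y_1^{[n]},y_2^{[n]}\mid x^{[n]})$. A rate pair is achievable if there is a sequence of schemes with $\max_k\Pr(\hat W_k\ne W_k)\to0$ and $\lim_n\frac1n\log_2|\mathcal M_k^{(n)}|\ge R_k$; capacity regions are closures of achievable pairs, and sum-capacity is the maximum of $R_1+R_2$ over the region. *)

theory Defs
  imports "HOL-Analysis.Analysis"
begin

text \<open>A 2-user discrete memoryless broadcast channel with finite alphabets
  X = {..<nX}, Y1 = {..<nY1}, Y2 = {..<nY2} and transition law W x y1 y2.\<close>
record bc =
  nX  :: nat
  nY1 :: nat
  nY2 :: nat
  W   :: "nat \<Rightarrow> nat \<Rightarrow> nat \<Rightarrow> real"

definition is_bc :: "bc \<Rightarrow> bool" where
  "is_bc N \<longleftrightarrow> nX N \<ge> 1 \<and> nY1 N \<ge> 1 \<and> nY2 N \<ge> 1 \<and>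
     (\<forall>x<nX N. \<forall>y1<nY1 N. \<forall>y2<nY2 N. W N x y1 y2 \<ge> 0) \<and>
     (\<forall>x<nX N. (\<Sum>y1<nY1 N. \<Sum>y2<nY2 N. W N x y1 y2) = 1)"

definition marg1 :: "bc \<Rightarrow> nat \<Rightarrow> nat \<Rightarrow> real" where
  "marg1 N x y1 = (\<Sum>y2<nY2 N. W N x y1 y2)"

definition marg2 :: "bc \<Rightarrow> nat \<Rightarrow> nat \<Rightarrow> real" where
  "marg2 N x y2 = (\<Sum>y1<nY1 N. W N x y1 y2)"

definition semidet :: "bc \<Rightarrow> bool" where
  "semidet N \<longleftrightarrow> is_bc N \<and>
     ((\<forall>x<nX N. \<forall>y<nY1 N. marg1 N x y \<in> {0, 1}) \<or>
      (\<forall>x<nX N. \<forall>y<nY2 N. marg2 N x y \<in> {0, 1}))"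

definition seqs :: "nat \<Rightarrow> nat \<Rightarrow> nat list set" where
  "seqs k n = {xs. length xs = n \<and> (\<forall>a\<in>set xs. a < k)}"

definition chanN :: "bc \<Rightarrow> nat list \<Rightarrow> nat list \<Rightarrow> nat list \<Rightarrow> real" where
  "chanN N xs ys1 ys2 = (\<Prod>i<length xs. W N (xs ! i) (ys1 ! i) (ys2 ! i))"

text \<open>A (coding) box Z x w1hat w2hat (w1,w2) y1 y2: outputs (x^n, w1hat, w2hat),
  inputs ((w1,w2), y1^n, y2^n).\<close>
type_synonym box = "nat list \<Rightarrow> nat \<Rightarrow> nat \<Rightarrow> nat \<times> nat \<Rightarrow> nat list \<Rightarrow> nat list \<Rightarrow> real"

definition cond_pmf_box :: "bc \<Rightarrow> nat \<Rightarrow> nat \<Rightarrow> nat \<Rightarrow> box \<Rightarrow> bool" where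
  "cond_pmf_box N n m1 m2 Z \<longleftrightarrow>
     (\<forall>a1\<in>{..<m1} \<times> {..<m2}. \<forall>a2\<in>seqs (nY1 N) n. \<forall>a3\<in>seqs (nY2 N) n.
        (\<forall>x\<in>seqs (nX N) n. \<forall>b2<m1. \<forall>b3<m2. Z x b2 b3 a1 a2 a3 \<ge> 0) \<and>
        (\<Sum>x\<in>seqs (nX N) n. \<Sum>b2<m1. \<Sum>b3<m2. Z x b2 b3 a1 a2 a3) = 1)"

definition ns_box :: "bc \<Rightarrow> nat \<Rightarrow> nat \<Rightarrow> nat \<Rightarrow> box \<Rightarrow> bool" where
  "ns_box N n m1 m2 Z \<longleftrightarrow>
   (let A1 = {..<m1} \<times> {..<m2}; A2 = seqs (nY1 N) n; A3 = seqs (nY2 N) n;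
        B1 = seqs (nX N) n; B2 = {..<m1}; B3 = {..<m2} in
   \<comment> \<open>subset {Tx, Rx1}\<close>
   (\<forall>a1\<in>A1. \<forall>a2\<in>A2. \<forall>a3\<in>A3. \<forall>a3'\<in>A3. \<forall>b1\<in>B1. \<forall>b2\<in>B2.
      (\<Sum>b3\<in>B3. Z b1 b2 b3 a1 a2 a3) = (\<Sum>b3\<in>B3. Z b1 b2 b3 a1 a2 a3')) \<and>
   \<comment> \<open>subset {Tx, Rx2}\<close>
   (\<forall>a1\<in>A1. \<forall>a2\<in>A2. \<forall>a2'\<in>A2. \<forall>a3\<in>A3. \<forall>b1\<in>B1. \<forall>b3\<in>B3.
      (\<Sum>b2\<in>B2. Z b1 b2 b3 a1 a2 a3) = (\<Sum>b2\<in>B2. Z b1 b2 b3 a1 a2' a3)) \<and>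
   \<comment> \<open>subset {Rx1, Rx2}\<close>
   (\<forall>a1\<in>A1. \<forall>a1'\<in>A1. \<forall>a2\<in>A2. \<forall>a3\<in>A3. \<forall>b2\<in>B2. \<forall>b3\<in>B3.
      (\<Sum>b1\<in>B1. Z b1 b2 b3 a1 a2 a3) = (\<Sum>b1\<in>B1. Z b1 b2 b3 a1' a2 a3)) \<and>
   \<comment> \<open>subset {Tx}\<close>
   (\<forall>a1\<in>A1. \<forall>a2\<in>A2. \<forall>a2'\<in>A2. \<forall>a3\<in>A3. \<forall>a3'\<in>A3. \<forall>b1\<in>B1.
      (\<Sum>b2\<in>B2. \<Sum>b3\<in>B3. Z b1 b2 b3 a1 a2 a3) = (\<Sum>b2\<in>B2. \<Sum>b3\<in>B3. Z b1 b2 b3 a1 a2' a3')) \<and>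
   \<comment> \<open>subset {Rx1}\<close>
   (\<forall>a1\<in>A1. \<forall>a1'\<in>A1. \<forall>a2\<in>A2. \<forall>a3\<in>A3. \<forall>a3'\<in>A3. \<forall>b2\<in>B2.
      (\<Sum>b1\<in>B1. \<Sum>b3\<in>B3. Z b1 b2 b3 a1 a2 a3) = (\<Sum>b1\<in>B1. \<Sum>b3\<in>B3. Z b1 b2 b3 a1' a2 a3')) \<and>
   \<comment> \<open>subset {Rx2}\<close>
   (\<forall>a1\<in>A1. \<forall>a1'\<in>A1. \<forall>a2\<in>A2. \<forall>a2'\<in>A2. \<forall>a3\<in>A3. \<forall>b3\<in>B3.
      (\<Sum>b1\<in>B1. \<Sum>b2\<in>B2. Z b1 b2 b3 a1 a2 a3) = (\<Sum>b1\<in>B1. \<Sum>b2\<in>B2. Z b1 b2 b3 a1' a2' a3)))"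

definition ns_scheme :: "bc \<Rightarrow> nat \<Rightarrow> nat \<Rightarrow> nat \<Rightarrow> box \<Rightarrow> bool" where
  "ns_scheme N n m1 m2 Z \<longleftrightarrow> m1 \<ge> 1 \<and> m2 \<ge> 1 \<and> cond_pmf_box N n m1 m2 Z \<and> ns_box N n m1 m2 Z"

definition classical_scheme :: "bc \<Rightarrow> nat \<Rightarrow> nat \<Rightarrow> nat \<Rightarrow> box \<Rightarrow> bool" where
  "classical_scheme N n m1 m2 Z \<longleftrightarrow> m1 \<ge> 1 \<and> m2 \<ge> 1 \<and>
    (\<exists>(phi :: nat \<times> nat \<Rightarrow> nat list \<Rightarrow> real) (psi1 :: nat list \<Rightarrow> nat \<Rightarrow> real)
        (psi2 :: nat list \<Rightarrow> nat \<Rightarrow> real).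
      (\<forall>w\<in>{..<m1} \<times> {..<m2}. (\<forall>x\<in>seqs (nX N) n. phi w x \<ge> 0) \<and>
          (\<Sum>x\<in>seqs (nX N) n. phi w x) = 1) \<and>
      (\<forall>y\<in>seqs (nY1 N) n. (\<forall>b<m1. psi1 y b \<ge> 0) \<and> (\<Sum>b<m1. psi1 y b) = 1) \<and>
      (\<forall>y\<in>seqs (nY2 N) n. (\<forall>b<m2. psi2 y b \<ge> 0) \<and> (\<Sum>b<m2. psi2 y b) = 1) \<and>
      (\<forall>w\<in>{..<m1} \<times> {..<m2}. \<forall>y1\<in>seqs (nY1 N) n. \<forall>y2\<in>seqs (nY2 N) n.
         \<forall>x\<in>seqs (nX N) n. \<forall>b2<m1. \<forall>b3<m2.
           Z x b2 b3 w y1 y2 = phi w x * psi1 y1 b2 * psi2 y2 b3))"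

definition err1 :: "bc \<Rightarrow> nat \<Rightarrow> nat \<Rightarrow> nat \<Rightarrow> box \<Rightarrow> real" where
  "err1 N n m1 m2 Z = (1 / (real m1 * real m2)) *
     (\<Sum>w1<m1. \<Sum>w2<m2. \<Sum>x\<in>seqs (nX N) n. \<Sum>y1\<in>seqs (nY1 N) n. \<Sum>y2\<in>seqs (nY2 N) n.
        \<Sum>b2\<in>{..<m1} - {w1}. \<Sum>b3<m2. Z x b2 b3 (w1, w2) y1 y2 * chanN N x y1 y2)"

definition err2 :: "bc \<Rightarrow> nat \<Rightarrow> nat \<Rightarrow> nat \<Rightarrow> box \<Rightarrow> real" where
  "err2 N n m1 m2 Z = (1 / (real m1 * real m2)) *
     (\<Sum>w1<m1. \<Sum>w2<m2. \<Sum>x\<in>seqs (nX N) n. \<Sum>y1\<in>seqs (nY1 N) n. \<Sum>y2\<in>seqs (nY2 N) n.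
        \<Sum>b2<m1. \<Sum>b3\<in>{..<m2} - {w2}. Z x b2 b3 (w1, w2) y1 y2 * chanN N x y1 y2)"

definition achievable ::
  "(bc \<Rightarrow> nat \<Rightarrow> nat \<Rightarrow> nat \<Rightarrow> box \<Rightarrow> bool) \<Rightarrow> bc \<Rightarrow> real \<times> real \<Rightarrow> bool" where
  "achievable P N R \<longleftrightarrow>
    (\<exists>(m1 :: nat \<Rightarrow> nat) (m2 :: nat \<Rightarrow> nat) (Z :: nat \<Rightarrow> box).
       (\<forall>n. P N n (m1 n) (m2 n) (Z n)) \<and>
       (\<lambda>n. max (err1 N n (m1 n) (m2 n) (Z n)) (err2 N n (m1 n) (m2 n) (Z n))) \<longlonglongrightarrow> 0 \<and>
       (\<exists>L1. (\<lambda>n. log 2 (real (m1 n)) / real n) \<longlonglongrightarrow> L1 \<and> L1 \<ge> fst R) \<and>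
       (\<exists>L2. (\<lambda>n. log 2 (real (m2 n)) / real n) \<longlonglongrightarrow> L2 \<and> L2 \<ge> snd R))"

definition cap_region ::
  "(bc \<Rightarrow> nat \<Rightarrow> nat \<Rightarrow> nat \<Rightarrow> box \<Rightarrow> bool) \<Rightarrow> bc \<Rightarrow> (real \<times> real) set" where
  "cap_region P N = closure {R. achievable P N R}"

definition sum_cap :: "(bc \<Rightarrow> nat \<Rightarrow> nat \<Rightarrow> nat \<Rightarrow> box \<Rightarrow> bool) \<Rightarrow> bc \<Rightarrow> real" where
  "sum_cap P N = Sup ((\<lambda>R. fst R + snd R) ` cap_region P N)"

end

theory Submission
  imports Defs "HOL-Computational_Algebra.Primes"
begin

text \<open>Upper bound (for every broadcast channel): forgetting receiver 2, an NS box with \<open>m\<close>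
  messages yields weights as in the point-to-point metaconverse. Random coding with about \<open>m / n\<close>
  messages drawn from these weights gives a classical code for user 1 alone whose error is larger by
  at most \<open>1 / n\<close>. Hence each of the two NS rates is at most the classical sum-capacity, without any
  entropy computation.

  Lower bound: for a prime \<open>q\<close> send \<open>X = (x1, x2)\<close>, with \<open>Y1 = x1\<close> and \<open>Y2 = (s, x2 + s * x1)\<close> for
  a uniform slope \<open>s\<close> modulo \<open>q\<close>. As \<open>(x1, x2)\<close> and \<open>(x1, x2 + s * x1)\<close> determine each other, an NS
  box masks both outputs by a uniform \<open>X\<close> and achieves \<open>(log q, log q)\<close> without error. Classically, two
  inputs whose \<open>x1\<close> parts differ in \<open>d\<close> positions collide at receiver 2 with probability at most
  \<open>q\<^sup>-\<^sup>d\<close>, so a given input collides on average with at most \<open>2\<^sup>n\<close> of those that user 1 can tell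
  apart, and \<open>m1 * m2\<close> is at most of order \<open>(2 * q)\<^sup>n\<close>. The ratio is thus at least
  \<open>2 * log q / (1 + log q)\<close>.\<close>

section \<open>Sequences and one-shot coding bounds\<close>

lemma seqs_0: "seqs k 0 = {[]}"
  by (auto simp: seqs_def)

lemma seqs_Suc: "seqs k (Suc n) = (\<lambda>(y, ys). y # ys) ` ({..<k} \<times> seqs k n)"
  by (auto simp: seqs_def length_Suc_conv image_iff)

lemma finite_seqs [simp]: "finite (seqs k n)"
  by (induction n) (auto simp: seqs_0 seqs_Suc)

lemma seqs_nth: "xs \<in> seqs k n \<Longrightarrow> i < n \<Longrightarrow> xs ! i < k"
  by (auto simp: seqs_def)

lemma seqs_length: "xs \<in> seqs k n \<Longrightarrow> length xs = n"
  by (simp add: seqs_def)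

lemma replicate_in_seqs: "0 < k \<Longrightarrow> replicate n 0 \<in> seqs k n"
  by (auto simp: seqs_def)

text \<open>Splitting off the first letter turns the sum into a product of two sums, and induction
  treats the tail. Every single-letter formula for a memoryless quantity below comes from this
  distributive law.\<close>

lemma sum_seqs_prod:
  fixes f :: "nat \<Rightarrow> nat \<Rightarrow> 'a :: comm_semiring_1"
  shows "(\<Sum>ys\<in>seqs k n. \<Prod>i<n. f i (ys ! i)) = (\<Prod>i<n. \<Sum>y<k. f i y)"
proof (induction n arbitrary: f)
  case 0
  then show ?case by (simp add: seqs_0)
next
  case (Suc n)
  have "inj_on (\<lambda>(y, ys). y # ys) ({..<k} \<times> seqs k n)"
    by (auto simp: inj_on_def)
  then have "(\<Sum>ys\<in>seqs k (Suc n). \<Prod>i<Suc n. f i (ys ! i))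
      = (\<Sum>(y, ys)\<in>{..<k} \<times> seqs k n. f 0 y * (\<Prod>i<n. f (Suc i) (ys ! i)))"
    by (simp add: seqs_Suc sum.reindex prod.lessThan_Suc_shift case_prod_unfold del: prod.lessThan_Suc)
  also have "\<dots> = (\<Sum>y<k. f 0 y) * (\<Sum>ys\<in>seqs k n. \<Prod>i<n. f (Suc i) (ys ! i))"
    by (simp add: sum_product sum.cartesian_product)
  also have "\<dots> = (\<Prod>i<Suc n. \<Sum>y<k. f i y)"
    by (simp add: Suc.IH[of "\<lambda>i. f (Suc i)"] prod.lessThan_Suc_shift del: prod.lessThan_Suc)
  finally show ?case .
qed

lemma card_seqs: "card (seqs k n) = k ^ n"
  using sum_seqs_prod[of "\<lambda>_ _. 1 :: nat" n k] by simp

lemma sum_seqs_seqs_prod: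
  fixes f :: "nat \<Rightarrow> nat \<Rightarrow> nat \<Rightarrow> 'a :: comm_semiring_1"
  shows "(\<Sum>ys\<in>seqs k n. \<Sum>zs\<in>seqs l n. \<Prod>i<n. f i (ys ! i) (zs ! i)) = (\<Prod>i<n. \<Sum>y<k. \<Sum>z<l. f i y z)"
  proof -
  have "(\<Sum>zs\<in>seqs l n. \<Prod>i<n. f i (ys ! i) (zs ! i)) = (\<Prod>i<n. \<Sum>z<l. f i (ys ! i) z)" for ys
    by (rule sum_seqs_prod[of "\<lambda>i. f i (ys ! i)"])
  then show ?thesis
    using sum_seqs_prod[of "\<lambda>i y. \<Sum>z<l. f i y z" n k] by simp
qed

section \<open>Expectations over independently drawn codewords\<close>

lemma sum_PiE_prod_weighted:
  fixes q :: "'x \<Rightarrow> real"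
  assumes "finite I" "finite X" "sum q X = 1" "b \<in> I"
  shows "(\<Sum>c\<in>PiE I (\<lambda>_. X). (\<Prod>i\<in>I. q (c i)) * g (c b)) = (\<Sum>x\<in>X. q x * g x)"
proof -
  have "(\<Sum>c\<in>PiE I (\<lambda>_. X). (\<Prod>i\<in>I. q (c i)) * g (c b))
      = (\<Sum>c\<in>PiE I (\<lambda>_. X). \<Prod>i\<in>I. q (c i) * (if i = b then g (c i) else 1))"
    using assms by (simp add: prod.distrib prod.delta)
  also have "\<dots> = (\<Prod>i\<in>I. \<Sum>x\<in>X. q x * (if i = b then g x else 1))"
    using assms by (subst prod_sum_PiE) auto
  also have "\<dots> = (\<Prod>i\<in>I. if i = b then \<Sum>x\<in>X. q x * g x else 1)"
    using assms by (intro prod.cong) auto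
  also have "\<dots> = (\<Sum>x\<in>X. q x * g x)"
    using assms by simp
  finally show ?thesis .
qed

text \<open>Independence of two distinct codewords of a random codebook: all coordinates other than
  \<open>b\<close> and \<open>j\<close> contribute the factor \<open>sum q X = 1\<close>.\<close>

lemma sum_PiE_prod_weighted2:
  fixes q :: "'x \<Rightarrow> real"
  assumes "finite I" "finite X" "sum q X = 1" "b \<in> I" "j \<in> I" "b \<noteq> j"
  shows "(\<Sum>c\<in>PiE I (\<lambda>_. X). (\<Prod>i\<in>I. q (c i)) * (g (c b) * h (c j)))
      = (\<Sum>x\<in>X. q x * g x) * (\<Sum>x\<in>X. q x * h x)"
proof -
  have "(\<Sum>c\<in>PiE I (\<lambda>_. X). (\<Prod>i\<in>I. q (c i)) * (g (c b) * h (c j)))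
      = (\<Sum>c\<in>PiE I (\<lambda>_. X). \<Prod>i\<in>I. q (c i) * (if i = b then g (c i) else 1) * (if i = j then h (c i) else 1))"
    using assms by (simp add: prod.distrib prod.delta mult.assoc)
  also have "\<dots> = (\<Prod>i\<in>I. \<Sum>x\<in>X. q x * (if i = b then g x else 1) * (if i = j then h x else 1))"
    using assms by (subst prod_sum_PiE) auto
  also have "\<dots> = (\<Prod>i\<in>I. (if i = b then \<Sum>x\<in>X. q x * g x else 1) * (if i = j then \<Sum>x\<in>X. q x * h x else 1))"
    using assms by (intro prod.cong) auto
  also have "\<dots> = (\<Sum>x\<in>X. q x * g x) * (\<Sum>x\<in>X. q x * h x)"
    using assms by (simp add: prod.distrib)
  finally show ?thesis .
qed

text \<open>Derandomisation: if every value were below \<open>v\<close>, the average would be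
  strictly below \<open>v\<close>, because some weight is positive when the weights sum to
  one.\<close>

lemma exists_ge_average:
  fixes F :: "'c \<Rightarrow> real"
  assumes "finite A" "\<And>c. c \<in> A \<Longrightarrow> 0 \<le> p c" "sum p A = 1" "v \<le> (\<Sum>c\<in>A. p c * F c)"
  shows "\<exists>c\<in>A. v \<le> F c"
proof (rule ccontr)
  assume "\<not> ?thesis"
  then have lt: "\<And>c. c \<in> A \<Longrightarrow> F c < v" by force
  have "\<exists>c\<in>A. 0 < p c"
    using assms(2,3) by (metis not_less_iff_gr_or_eq order_le_less sum.neutral zero_neq_one)
  then obtain c0 where c0: "c0 \<in> A" "0 < p c0" by blast
  have "(\<Sum>c\<in>A. p c * F c) < (\<Sum>c\<in>A. p c * v)"
    using assms(1,2) c0 lt by (intro sum_strict_mono_ex1) (auto intro: mult_left_mono less_imp_le intro!: bexI[of _ c0])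
  also have "\<dots> = v"
    using assms(3) by (simp flip: sum_distrib_right)
  finally show False using assms(4) by simp
qed

text \<open>Given weights with marginals as in the metaconverse (\<open>r\<close> below \<open>p\<close>, column sums of \<open>r\<close> at most
  one), draw \<open>k\<close> codewords independently from \<open>p / M\<close>; the decoder accepts codeword \<open>x\<close> on output
  \<open>y\<close> with weight \<open>r x y / p x\<close> and picks among the codewords proportionally to these weights.\<close>

lemma random_code:
  fixes C r :: "'x \<Rightarrow> 'y \<Rightarrow> real" and p :: "'x \<Rightarrow> real" and M :: real and k :: nat
  assumes fin: "finite X" "finite Y" and k: "1 \<le> k" and M: "0 < M"
    and C: "\<And>x y. x \<in> X \<Longrightarrow> y \<in> Y \<Longrightarrow> 0 \<le> C x y"
    and r: "\<And>x y. x \<in> X \<Longrightarrow> y \<in> Y \<Longrightarrow> 0 \<le> r x y" "\<And>x y. x \<in> X \<Longrightarrow> y \<in> Y \<Longrightarrow> r x y \<le> p x"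
    and p: "\<And>x. x \<in> X \<Longrightarrow> 0 \<le> p x" "sum p X = M"
    and col: "\<And>y. y \<in> Y \<Longrightarrow> (\<Sum>x\<in>X. r x y) \<le> 1"
  shows "\<exists>c \<psi>. (\<forall>b<k. c b \<in> X) \<and> (\<forall>y\<in>Y. (\<forall>b<k. 0 \<le> \<psi> y b) \<and> (\<Sum>b<k. \<psi> y b) = 1) \<and>
     real k * (1 - (real k - 1) / M) * ((\<Sum>x\<in>X. \<Sum>y\<in>Y. C x y * r x y) / M) \<le> (\<Sum>b<k. \<Sum>y\<in>Y. C (c b) y * \<psi> y b)"
proof -
  define q where "q x = p x / M" for x
  \<comment> \<open>Where \<open>p x\<close> vanishes, \<open>r x y\<close> vanishes too, being
    squeezed between \<open>0\<close> and \<open>p x\<close>; the default \<open>0\<close> therefore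
    keeps \<open>qa\<close> true.\<close>
  define a where "a x y = (if p x = 0 then 0 else r x y / p x)" for x y
  have q0: "0 \<le> q x" if "x \<in> X" for x using p(1)[OF that] M by (simp add: q_def)
  have q1: "sum q X = 1" using p(2) M by (simp add: q_def flip: sum_divide_distrib)
  have a01: "0 \<le> a x y" "a x y \<le> 1" if "x \<in> X" "y \<in> Y" for x y
    using p(1)[OF that(1)] r[OF that] by (auto simp: a_def divide_simps)
  have qa: "q x * a x y = r x y / M" if "x \<in> X" "y \<in> Y" for x y
    using p(1)[OF that(1)] r[OF that] M by (auto simp: a_def q_def)
  define Sc where "Sc = (\<Sum>x\<in>X. \<Sum>y\<in>Y. C x y * r x y) / M"
  let ?E = "PiE {..<k} (\<lambda>_. X)"
  \<comment> \<open>\<open>G\<close> replaces the quotient in the success weight of codeword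
    \<open>b\<close> by a polynomial lower bound, whose expectation involves only single codewords
    and pairs of them.\<close>
  define G where "G c b y = C (c b) y * a (c b) y * (1 - (\<Sum>j\<in>{..<k} - {b}. a (c j) y))" for c :: "nat \<Rightarrow> 'x" and b y
  define w where "w c = (\<Prod>i<k. q (c i))" for c
  have finE: "finite ?E" using fin by (intro finite_PiE) auto
  \<comment> \<open>A competing codeword is independent of codeword \<open>b\<close> and by
    \<open>col\<close> has mean acceptance weight at most \<open>1 / M\<close>; the
    \<open>k - 1\<close> competitors together cost the factor
    \<open>1 - (k - 1) / M\<close>.\<close>
  have EG: "(\<Sum>x\<in>X. C x y * r x y) / M * (1 - (real k - 1) / M) \<le> (\<Sum>c\<in>?E. w c * G c b y)"
    if y: "y \<in> Y" and b: "b < k" for y b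
  proof -
    let ?T = "(\<Sum>x\<in>X. C x y * r x y) / M"
    have T0: "0 \<le> ?T"
      using C r(1) y M by (intro divide_nonneg_pos sum_nonneg mult_nonneg_nonneg) auto
    have one: "(\<Sum>c\<in>?E. w c * (C (c b) y * a (c b) y)) = ?T"
      unfolding w_def
      using sum_PiE_prod_weighted[of "{..<k}" X q b "\<lambda>x. C x y * a x y"] fin q1 b
      by (simp add: sum_divide_distrib) (intro sum.cong refl, use qa y in \<open>simp add: mult.left_commute[of "q _"]\<close>)
    have two: "(\<Sum>c\<in>?E. w c * (C (c b) y * a (c b) y * a (c j) y)) \<le> ?T * (1 / M)"
      if j: "j \<in> {..<k} - {b}" for j
    proof -
      have "(\<Sum>c\<in>?E. w c * (C (c b) y * a (c b) y * a (c j) y))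
          = (\<Sum>x\<in>X. q x * (C x y * a x y)) * (\<Sum>x\<in>X. q x * a x y)"
        unfolding w_def
        using sum_PiE_prod_weighted2[of "{..<k}" X q b j "\<lambda>x. C x y * a x y" "\<lambda>x. a x y"] fin q1 b j
        by simp
      also have "(\<Sum>x\<in>X. q x * (C x y * a x y)) = ?T"
        by (simp add: sum_divide_distrib) (intro sum.cong refl, use qa y in \<open>simp add: mult.left_commute[of "q _"]\<close>)
      also have "(\<Sum>x\<in>X. q x * a x y) = (\<Sum>x\<in>X. r x y) / M"
        using qa y by (simp add: sum_divide_distrib)
      also have "?T * ((\<Sum>x\<in>X. r x y) / M) \<le> ?T * (1 / M)"
        using col[OF y] M T0 by (intro mult_left_mono divide_right_mono) auto
      finally show ?thesis .
    qed
    have "(\<Sum>c\<in>?E. w c * G c b y)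
        = (\<Sum>c\<in>?E. w c * (C (c b) y * a (c b) y))
          - (\<Sum>j\<in>{..<k} - {b}. \<Sum>c\<in>?E. w c * (C (c b) y * a (c b) y * a (c j) y))"
      by (subst sum.swap)
        (simp add: G_def right_diff_distrib sum_subtractf sum_distrib_left mult.assoc)
    also have "\<dots> \<ge> ?T - (\<Sum>j\<in>{..<k} - {b}. ?T * (1 / M))"
      unfolding one by (intro diff_left_mono sum_mono two)
    also have "?T - (\<Sum>j\<in>{..<k} - {b}. ?T * (1 / M)) = ?T * (1 - (real k - 1) / M)"
    proof -
      have "T - (\<Sum>j\<in>{..<k} - {b}. T * (1 / M)) = T * (1 - (real k - 1) / M)" for T
        using b by (simp add: of_nat_diff right_diff_distrib left_diff_distrib mult.commute diff_divide_distrib)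
      then show ?thesis .
    qed
    finally show ?thesis .
  qed
  have w0: "0 \<le> w c" if "c \<in> ?E" for c
    unfolding w_def using that q0 by (intro prod_nonneg) (auto simp: PiE_iff)
  have w1: "sum w ?E = 1"
    unfolding w_def using prod_sum_PiE[of "{..<k}" "\<lambda>_. X" "\<lambda>_. q"] fin q1 by simp
  have "real k * (1 - (real k - 1) / M) * Sc
      = (\<Sum>b<k. \<Sum>y\<in>Y. (\<Sum>x\<in>X. C x y * r x y) / M * (1 - (real k - 1) / M))"
    by (simp add: Sc_def sum.swap[of _ X Y] sum_divide_distrib sum_distrib_left sum_distrib_right mult_ac)
  also have "\<dots> \<le> (\<Sum>b<k. \<Sum>y\<in>Y. \<Sum>c\<in>?E. w c * G c b y)"
    by (intro sum_mono EG) auto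
  also have "\<dots> = (\<Sum>b<k. \<Sum>c\<in>?E. \<Sum>y\<in>Y. w c * G c b y)"
    by (intro sum.cong refl sum.swap)
  also have "\<dots> = (\<Sum>c\<in>?E. \<Sum>b<k. \<Sum>y\<in>Y. w c * G c b y)"
    by (rule sum.swap)
  also have "\<dots> = (\<Sum>c\<in>?E. w c * (\<Sum>b<k. \<Sum>y\<in>Y. G c b y))"
    by (simp add: sum_distrib_left)
  finally have avg: "real k * (1 - (real k - 1) / M) * Sc \<le> (\<Sum>c\<in>?E. w c * (\<Sum>b<k. \<Sum>y\<in>Y. G c b y))" .
  have "\<exists>c\<in>?E. real k * (1 - (real k - 1) / M) * Sc \<le> (\<Sum>b<k. \<Sum>y\<in>Y. G c b y)"
    using exists_ge_average[of ?E w _ "\<lambda>c. \<Sum>b<k. \<Sum>y\<in>Y. G c b y"] finE w0 w1 avg by simp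
  then obtain c where c: "c \<in> ?E" and ge: "real k * (1 - (real k - 1) / M) * Sc \<le> (\<Sum>b<k. \<Sum>y\<in>Y. G c b y)"
    by blast
  have cX: "c b \<in> X" if "b < k" for b using c that by (auto simp: PiE_iff)
  \<comment> \<open>If no codeword receives any weight, the decoder answers \<open>0\<close>, which
    is a message since \<open>1 \<le> k\<close>.\<close>
  define \<psi> where "\<psi> y b = (let s = (\<Sum>j<k. a (c j) y) in if s = 0 then (if b = 0 then 1 else 0) else a (c b) y / s)" for y b
  have \<psi>: "(\<forall>b<k. 0 \<le> \<psi> y b) \<and> (\<Sum>b<k. \<psi> y b) = 1" if y: "y \<in> Y" for y
  proof -
    have s: "0 \<le> (\<Sum>j<k. a (c j) y)" using a01 cX y by (intro sum_nonneg) auto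
    show ?thesis
    proof (cases "(\<Sum>j<k. a (c j) y) = 0")
      case True
      then show ?thesis using k by (simp add: \<psi>_def sum.delta)
    next
      case False
      then show ?thesis using s a01 cX y by (auto simp: \<psi>_def simp flip: sum_divide_distrib)
    qed
  qed
  have "G c b y \<le> C (c b) y * \<psi> y b" if y: "y \<in> Y" and b: "b < k" for b y
  proof -
    let ?a = "a (c b) y" and ?S = "\<Sum>j\<in>{..<k} - {b}. a (c j) y"
    have S: "0 \<le> ?S" using a01 cX y by (intro sum_nonneg) auto
    have tot: "(\<Sum>j<k. a (c j) y) = ?a + ?S" using b by (simp add: sum.remove)
    have ab: "0 \<le> ?a" "?a \<le> 1" using a01 cX y b by auto
    have "?a * (1 - ?S) \<le> \<psi> y b"
    proof (cases "?a = 0")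
      case True
      then show ?thesis using \<psi>[OF y] b by simp
    next
      case False
      \<comment> \<open>This clears the denominator \<open>?a + ?S\<close>, which is positive
        because \<open>?a\<close> is. For \<open>?S \<le> 1\<close> it follows from
        \<open>(1 - ?a) * (1 - ?S) \<ge> 0\<close>; for \<open>?S > 1\<close> the left side is not
        positive.\<close>
      have "(1 - ?S) * (?a + ?S) \<le> 1"
      proof -
        have "(1 - ?S) * (?a + ?S) = ?a - ?S * ?a + ?S - ?S * ?S" by (simp add: algebra_simps)
        moreover have "?a + ?S - ?S * ?a \<le> 1" if "?S \<le> 1"
          using mult_nonneg_nonneg[of "1 - ?a" "1 - ?S"] that ab by (simp add: algebra_simps)
        moreover have "(1 - ?S) * (?a + ?S) \<le> 0" if "?S > 1"
          using that ab S by (intro mult_nonpos_nonneg) auto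
        ultimately show ?thesis using S by (smt (verit) mult_nonneg_nonneg)
      qed
      then have "?a * ((1 - ?S) * (?a + ?S)) \<le> ?a * 1"
        using ab by (intro mult_left_mono)
      then show ?thesis using False ab S by (simp add: \<psi>_def tot pos_le_divide_eq mult.assoc)
    qed
    then show ?thesis
      unfolding G_def mult.assoc using C cX y b by (intro mult_left_mono) auto
  qed
  then have "(\<Sum>b<k. \<Sum>y\<in>Y. G c b y) \<le> (\<Sum>b<k. \<Sum>y\<in>Y. C (c b) y * \<psi> y b)"
    by (intro sum_mono) auto
  then show ?thesis
    using ge cX \<psi> unfolding Sc_def by (intro exI[of _ c] exI[of _ \<psi>]) auto
qed

text \<open>The weight \<open>N v y\<close> is the average number of messages \<open>w\<close> that could cause output \<open>y\<close>; its second
  moment is controlled by the collision bound \<open>c\<close>, while \<open>N * g \<le> \<kappa> * g + N\<^sup>2 / (4 * \<kappa>)\<close> for \<open>g \<le> 1\<close>.\<close>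

lemma one_shot_converse:
  fixes phi :: "'w \<Rightarrow> 'v \<Rightarrow> 'x \<Rightarrow> real" and h :: "'z \<Rightarrow> 'w \<Rightarrow> real" and g :: "'y \<Rightarrow> 'v \<Rightarrow> real"
    and P :: "'x \<Rightarrow> 'y \<Rightarrow> real" and c :: "'z \<Rightarrow> 'z \<Rightarrow> real"
  assumes fin: "finite A" "finite B" "finite X" "finite Y" "finite Z"
    and phi: "\<And>w v x. w \<in> A \<Longrightarrow> v \<in> B \<Longrightarrow> x \<in> X \<Longrightarrow> 0 \<le> phi w v x"
      "\<And>w v. w \<in> A \<Longrightarrow> v \<in> B \<Longrightarrow> (\<Sum>x\<in>X. phi w v x) = 1"
    and h: "\<And>z w. z \<in> Z \<Longrightarrow> w \<in> A \<Longrightarrow> 0 \<le> h z w" "\<And>z. z \<in> Z \<Longrightarrow> (\<Sum>w\<in>A. h z w) = 1"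
    and g: "\<And>y v. y \<in> Y \<Longrightarrow> v \<in> B \<Longrightarrow> 0 \<le> g y v" "\<And>y. y \<in> Y \<Longrightarrow> (\<Sum>v\<in>B. g y v) = 1"
    and f: "\<And>x. x \<in> X \<Longrightarrow> f x \<in> Z"
    and P: "\<And>x y. x \<in> X \<Longrightarrow> y \<in> Y \<Longrightarrow> 0 \<le> P x y"
    and c: "\<And>x x'. x \<in> X \<Longrightarrow> x' \<in> X \<Longrightarrow> (\<Sum>y\<in>Y. P x y * P x' y) \<le> c (f x) (f x')"
      "\<And>z z'. z \<in> Z \<Longrightarrow> z' \<in> Z \<Longrightarrow> 0 \<le> c z z'"
      "\<And>z. z \<in> Z \<Longrightarrow> (\<Sum>z'\<in>Z. c z z') \<le> \<kappa>"
    and \<kappa>: "0 < \<kappa>"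
  shows "(\<Sum>w\<in>A. \<Sum>v\<in>B. \<Sum>x\<in>X. \<Sum>y\<in>Y. phi w v x * h (f x) w * g y v * P x y)
      \<le> real (card Y) * \<kappa> + real (card A) * real (card B) / 4"
proof -
  \<comment> \<open>Given the messages \<open>w\<close> and \<open>v\<close>,
    \<open>u v (w, x)\<close> is the probability that \<open>x\<close> is sent and the first
    receiver, who sees \<open>f x\<close>, outputs \<open>w\<close>.\<close>
  define u where "u v = (\<lambda>(w, x). phi w v x * h (f x) w)" for v
  define N where "N v y = (\<Sum>i\<in>A \<times> X. u v i * P (snd i) y)" for v y
  have finAX: "finite (A \<times> X)" using fin by simp
  have u0: "0 \<le> u v i" if "v \<in> B" "i \<in> A \<times> X" for v i
    using that phi(1) h(1) f by (auto simp: u_def)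
  have h1: "h z w \<le> 1" if "z \<in> Z" "w \<in> A" for z w
    using h(2)[OF that(1)] member_le_sum[of w A "h z"] h(1) that fin by auto
  have usum: "(\<Sum>i\<in>A \<times> X. u v i) \<le> card A" if v: "v \<in> B" for v
  proof -
    have "(\<Sum>i\<in>A \<times> X. u v i) = (\<Sum>w\<in>A. \<Sum>x\<in>X. phi w v x * h (f x) w)"
      by (simp add: u_def sum.cartesian_product)
    also have "\<dots> \<le> (\<Sum>w\<in>A. \<Sum>x\<in>X. phi w v x * 1)"
      using phi(1) h1 f v by (intro sum_mono mult_left_mono) auto
    also have "\<dots> = card A" using phi(2) v by simp
    finally show ?thesis .
  qed
  have inner: "(\<Sum>j\<in>A \<times> X. u v j * c z (f (snd j))) \<le> \<kappa>" if v: "v \<in> B" and z: "z \<in> Z" for v z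
  proof -
    have "(\<Sum>j\<in>A \<times> X. u v j * c z (f (snd j))) = (\<Sum>w\<in>A. \<Sum>x\<in>X. phi w v x * (h (f x) w * c z (f x)))"
      by (simp add: u_def sum.cartesian_product case_prod_unfold mult.assoc)
    \<comment> \<open>The term at \<open>f x\<close> is bounded by the sum over all first outputs,
      which no longer depends on \<open>x\<close>. Then \<open>phi\<close> sums to one over
      \<open>x\<close>, and afterwards \<open>h\<close> sums to one over \<open>w\<close>.\<close>
    also have "\<dots> \<le> (\<Sum>w\<in>A. \<Sum>x\<in>X. phi w v x * (\<Sum>z'\<in>Z. h z' w * c z z'))"
    proof (intro sum_mono mult_left_mono)
      fix w x assume wx: "w \<in> A" "x \<in> X"
      show "h (f x) w * c z (f x) \<le> (\<Sum>z'\<in>Z. h z' w * c z z')"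
        using h(1) c(2) f[OF wx(2)] wx z fin
        by (intro member_le_sum[of "f x" Z "\<lambda>z'. h z' w * c z z'"]) auto
    qed (use phi(1) v in auto)
    also have "\<dots> = (\<Sum>w\<in>A. \<Sum>z'\<in>Z. h z' w * c z z')"
      using phi(2) v by (simp flip: sum_distrib_right)
    also have "\<dots> = (\<Sum>z'\<in>Z. \<Sum>w\<in>A. h z' w * c z z')"
      by (rule sum.swap)
    also have "\<dots> = (\<Sum>z'\<in>Z. c z z')"
      using h(2) by (simp flip: sum_distrib_right)
    finally show ?thesis using c(3)[OF z] by simp
  qed
  \<comment> \<open>Expanding the square turns the sum over \<open>y\<close> into collision weights
    of pairs of inputs, which \<open>c\<close> bounds.\<close>
  have second: "(\<Sum>y\<in>Y. (N v y)\<^sup>2) \<le> card A * \<kappa>" if v: "v \<in> B" for v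
  proof -
    have "(\<Sum>y\<in>Y. (N v y)\<^sup>2)
        = (\<Sum>y\<in>Y. \<Sum>i\<in>A \<times> X. \<Sum>j\<in>A \<times> X. u v i * (u v j * (P (snd i) y * P (snd j) y)))"
      unfolding N_def power2_eq_square sum_product by (simp add: mult_ac)
    also have "\<dots> = (\<Sum>i\<in>A \<times> X. \<Sum>y\<in>Y. \<Sum>j\<in>A \<times> X. u v i * (u v j * (P (snd i) y * P (snd j) y)))"
      by (rule sum.swap)
    also have "\<dots> = (\<Sum>i\<in>A \<times> X. u v i * (\<Sum>j\<in>A \<times> X. u v j * (\<Sum>y\<in>Y. P (snd i) y * P (snd j) y)))"
      unfolding sum_distrib_left by (intro sum.cong refl sum.swap)
    also have "\<dots> \<le> (\<Sum>i\<in>A \<times> X. u v i * (\<Sum>j\<in>A \<times> X. u v j * c (f (snd i)) (f (snd j))))"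
      using u0 v c(1) by (intro sum_mono mult_left_mono) auto
    also have "\<dots> \<le> (\<Sum>i\<in>A \<times> X. u v i * \<kappa>)"
      using u0 v f inner by (intro sum_mono mult_left_mono) auto
    also have "\<dots> \<le> card A * \<kappa>"
      using usum[OF v] \<kappa> by (simp flip: sum_distrib_right)
    finally show ?thesis .
  qed
  have point: "g y v * N v y \<le> \<kappa> * g y v + (N v y)\<^sup>2 / (4 * \<kappa>)" if "v \<in> B" "y \<in> Y" for v y
  proof -
    have g1: "g y v \<le> 1"
      using g(2)[OF that(2)] member_le_sum[of v B "g y"] g(1) that fin by auto
    have g0: "0 \<le> g y v" using g(1) that by auto
    \<comment> \<open>Completing the square at \<open>2 * \<kappa>\<close> is chosen so that, by
      \<open>second\<close>, the quadratic terms add up to a quarter of the number of message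
      pairs.\<close>
    have "0 \<le> (N v y - 2 * \<kappa>)\<^sup>2 / (4 * \<kappa>)" using \<kappa> by simp
    also have "\<dots> = (N v y)\<^sup>2 / (4 * \<kappa>) - N v y + \<kappa>"
      using \<kappa> by (simp add: field_simps power2_eq_square)
    finally have "N v y - \<kappa> \<le> (N v y)\<^sup>2 / (4 * \<kappa>)" by simp
    then have "g y v * (N v y - \<kappa>) \<le> g y v * ((N v y)\<^sup>2 / (4 * \<kappa>))"
      using g0 by (intro mult_left_mono)
    also have "\<dots> \<le> 1 * ((N v y)\<^sup>2 / (4 * \<kappa>))"
      using g1 \<kappa> by (intro mult_right_mono) auto
    finally show ?thesis by (simp add: algebra_simps)
  qed
  have "(\<Sum>w\<in>A. \<Sum>v\<in>B. \<Sum>x\<in>X. \<Sum>y\<in>Y. phi w v x * h (f x) w * g y v * P x y)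
      = (\<Sum>v\<in>B. \<Sum>w\<in>A. \<Sum>x\<in>X. \<Sum>y\<in>Y. phi w v x * h (f x) w * g y v * P x y)"
    by (rule sum.swap)
  also have "\<dots> = (\<Sum>v\<in>B. \<Sum>i\<in>A \<times> X. \<Sum>y\<in>Y. g y v * (u v i * P (snd i) y))"
    by (simp add: u_def sum.cartesian_product[where A = A and B = X] case_prod_unfold mult_ac)
  also have "\<dots> = (\<Sum>v\<in>B. \<Sum>y\<in>Y. g y v * N v y)"
    unfolding N_def sum_distrib_left by (intro sum.cong refl sum.swap)
  also have "\<dots> \<le> (\<Sum>v\<in>B. \<Sum>y\<in>Y. \<kappa> * g y v + (N v y)\<^sup>2 / (4 * \<kappa>))"
    by (intro sum_mono point)
  also have "\<dots> = \<kappa> * (\<Sum>v\<in>B. \<Sum>y\<in>Y. g y v) + (\<Sum>v\<in>B. \<Sum>y\<in>Y. (N v y)\<^sup>2) / (4 * \<kappa>)"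
    by (simp add: sum.distrib sum_distrib_left sum_divide_distrib)
  also have "(\<Sum>v\<in>B. \<Sum>y\<in>Y. g y v) = card Y"
    using g(2) by (subst sum.swap) simp
  also have "(\<Sum>v\<in>B. \<Sum>y\<in>Y. (N v y)\<^sup>2) / (4 * \<kappa>) \<le> (\<Sum>v\<in>B. card A * \<kappa>) / (4 * \<kappa>)"
    using second \<kappa> by (intro divide_right_mono sum_mono) auto
  also have "\<dots> = real (card A) * real (card B) / 4"
    using \<kappa> by simp
  finally show ?thesis by (simp add: mult.commute)
qed

section \<open>From NS boxes to point-to-point classical codes\<close>

lemma chanN_eq: "xs \<in> seqs k n \<Longrightarrow> chanN N xs ys1 ys2 = (\<Prod>i<n. W N (xs ! i) (ys1 ! i) (ys2 ! i))"
  by (simp add: chanN_def seqs_def)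

lemma chanN_nonneg:
  assumes "is_bc N" "xs \<in> seqs (nX N) n" "ys1 \<in> seqs (nY1 N) n" "ys2 \<in> seqs (nY2 N) n"
  shows "0 \<le> chanN N xs ys1 ys2"
  using assms by (auto simp: chanN_eq[OF assms(2)] is_bc_def seqs_nth intro!: prod_nonneg)

lemma sum_chanN:
  assumes "is_bc N" "xs \<in> seqs (nX N) n"
  shows "(\<Sum>ys1\<in>seqs (nY1 N) n. \<Sum>ys2\<in>seqs (nY2 N) n. chanN N xs ys1 ys2) = 1"
proof -
  have "(\<Sum>ys1\<in>seqs (nY1 N) n. \<Sum>ys2\<in>seqs (nY2 N) n. chanN N xs ys1 ys2)
      = (\<Prod>i<n. \<Sum>y1<nY1 N. \<Sum>y2<nY2 N. W N (xs ! i) y1 y2)"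
    using sum_seqs_seqs_prod[of "\<lambda>i. W N (xs ! i)" n "nY2 N" "nY1 N"]
    by (simp add: chanN_eq[OF assms(2)])
  also have "\<dots> = 1"
    using assms by (intro prod.neutral) (auto simp: is_bc_def seqs_nth)
  finally show ?thesis .
qed

text \<open>Marginals of a single party are obtained from those of two parties containing it.\<close>

lemma ns_boxI:
  assumes 1: "\<And>a1 a2 a3 a3' b1 b2. \<lbrakk>a1 \<in> {..<m1} \<times> {..<m2}; a2 \<in> seqs (nY1 N) n; a3 \<in> seqs (nY2 N) n;
      a3' \<in> seqs (nY2 N) n; b1 \<in> seqs (nX N) n; b2 < m1\<rbrakk>
      \<Longrightarrow> (\<Sum>b3<m2. Z b1 b2 b3 a1 a2 a3) = (\<Sum>b3<m2. Z b1 b2 b3 a1 a2 a3')"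
    and 2: "\<And>a1 a2 a2' a3 b1 b3. \<lbrakk>a1 \<in> {..<m1} \<times> {..<m2}; a2 \<in> seqs (nY1 N) n; a2' \<in> seqs (nY1 N) n;
      a3 \<in> seqs (nY2 N) n; b1 \<in> seqs (nX N) n; b3 < m2\<rbrakk>
      \<Longrightarrow> (\<Sum>b2<m1. Z b1 b2 b3 a1 a2 a3) = (\<Sum>b2<m1. Z b1 b2 b3 a1 a2' a3)"
    and 3: "\<And>a1 a1' a2 a3 b2 b3. \<lbrakk>a1 \<in> {..<m1} \<times> {..<m2}; a1' \<in> {..<m1} \<times> {..<m2}; a2 \<in> seqs (nY1 N) n;
      a3 \<in> seqs (nY2 N) n; b2 < m1; b3 < m2\<rbrakk>
      \<Longrightarrow> (\<Sum>b1\<in>seqs (nX N) n. Z b1 b2 b3 a1 a2 a3) = (\<Sum>b1\<in>seqs (nX N) n. Z b1 b2 b3 a1' a2 a3)"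
  shows "ns_box N n m1 m2 Z"
proof -
  let ?X = "seqs (nX N) n" and ?Y1 = "seqs (nY1 N) n" and ?Y2 = "seqs (nY2 N) n"
  have 4: "(\<Sum>b2<m1. \<Sum>b3<m2. Z b1 b2 b3 a1 a2 a3) = (\<Sum>b2<m1. \<Sum>b3<m2. Z b1 b2 b3 a1 a2' a3')"
    if "a1 \<in> {..<m1} \<times> {..<m2}" "a2 \<in> ?Y1" "a2' \<in> ?Y1" "a3 \<in> ?Y2" "a3' \<in> ?Y2" "b1 \<in> ?X"
    for a1 a2 a2' a3 a3' b1
  proof -
    have "(\<Sum>b2<m1. \<Sum>b3<m2. Z b1 b2 b3 a1 a2 a3) = (\<Sum>b2<m1. \<Sum>b3<m2. Z b1 b2 b3 a1 a2 a3')"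
      using that by (intro sum.cong refl 1) auto
    also have "\<dots> = (\<Sum>b3<m2. \<Sum>b2<m1. Z b1 b2 b3 a1 a2 a3')"
      by (rule sum.swap)
    also have "\<dots> = (\<Sum>b3<m2. \<Sum>b2<m1. Z b1 b2 b3 a1 a2' a3')"
      using that by (intro sum.cong refl 2) auto
    finally show ?thesis by (simp add: sum.swap[of _ "{..<m2}" "{..<m1}"])
  qed
  have 5: "(\<Sum>b1\<in>?X. \<Sum>b3<m2. Z b1 b2 b3 a1 a2 a3) = (\<Sum>b1\<in>?X. \<Sum>b3<m2. Z b1 b2 b3 a1' a2 a3')"
    if "a1 \<in> {..<m1} \<times> {..<m2}" "a1' \<in> {..<m1} \<times> {..<m2}" "a2 \<in> ?Y1" "a3 \<in> ?Y2" "a3' \<in> ?Y2" "b2 < m1"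
    for a1 a1' a2 a3 a3' b2
  proof -
    have "(\<Sum>b1\<in>?X. \<Sum>b3<m2. Z b1 b2 b3 a1 a2 a3) = (\<Sum>b1\<in>?X. \<Sum>b3<m2. Z b1 b2 b3 a1 a2 a3')"
      using that by (intro sum.cong refl 1) auto
    also have "\<dots> = (\<Sum>b3<m2. \<Sum>b1\<in>?X. Z b1 b2 b3 a1 a2 a3')"
      by (rule sum.swap)
    also have "\<dots> = (\<Sum>b3<m2. \<Sum>b1\<in>?X. Z b1 b2 b3 a1' a2 a3')"
      using that by (intro sum.cong refl 3) auto
    finally show ?thesis by (simp add: sum.swap[of _ "{..<m2}" ?X])
  qed
  have 6: "(\<Sum>b1\<in>?X. \<Sum>b2<m1. Z b1 b2 b3 a1 a2 a3) = (\<Sum>b1\<in>?X. \<Sum>b2<m1. Z b1 b2 b3 a1' a2' a3)"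
    if "a1 \<in> {..<m1} \<times> {..<m2}" "a1' \<in> {..<m1} \<times> {..<m2}" "a2 \<in> ?Y1" "a2' \<in> ?Y1" "a3 \<in> ?Y2" "b3 < m2"
    for a1 a1' a2 a2' a3 b3
  proof -
    have "(\<Sum>b1\<in>?X. \<Sum>b2<m1. Z b1 b2 b3 a1 a2 a3) = (\<Sum>b1\<in>?X. \<Sum>b2<m1. Z b1 b2 b3 a1 a2' a3)"
      using that by (intro sum.cong refl 2) auto
    also have "\<dots> = (\<Sum>b2<m1. \<Sum>b1\<in>?X. Z b1 b2 b3 a1 a2' a3)"
      by (rule sum.swap)
    also have "\<dots> = (\<Sum>b2<m1. \<Sum>b1\<in>?X. Z b1 b2 b3 a1' a2' a3)"
      using that by (intro sum.cong refl 3) auto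
    finally show ?thesis by (simp add: sum.swap[of _ "{..<m1}" ?X])
  qed
  show ?thesis
    unfolding ns_box_def Let_def
    by (intro conjI ballI) (simp_all only: lessThan_iff, (rule 1 2 3 4 5 6; assumption)+)
qed

lemma ns_boxD:
  assumes "ns_box N n m1 m2 Z"
  shows ns_box_Tx_Rx1: "\<And>a1 a2 a3 a3' b1 b2. \<lbrakk>a1 \<in> {..<m1} \<times> {..<m2}; a2 \<in> seqs (nY1 N) n; a3 \<in> seqs (nY2 N) n;
      a3' \<in> seqs (nY2 N) n; b1 \<in> seqs (nX N) n; b2 < m1\<rbrakk>
      \<Longrightarrow> (\<Sum>b3<m2. Z b1 b2 b3 a1 a2 a3) = (\<Sum>b3<m2. Z b1 b2 b3 a1 a2 a3')"
    and ns_box_Tx_Rx2: "\<And>a1 a2 a2' a3 b1 b3. \<lbrakk>a1 \<in> {..<m1} \<times> {..<m2}; a2 \<in> seqs (nY1 N) n; a2' \<in> seqs (nY1 N) n;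
      a3 \<in> seqs (nY2 N) n; b1 \<in> seqs (nX N) n; b3 < m2\<rbrakk>
      \<Longrightarrow> (\<Sum>b2<m1. Z b1 b2 b3 a1 a2 a3) = (\<Sum>b2<m1. Z b1 b2 b3 a1 a2' a3)"
    and ns_box_Rx1_Rx2: "\<And>a1 a1' a2 a3 b2 b3. \<lbrakk>a1 \<in> {..<m1} \<times> {..<m2}; a1' \<in> {..<m1} \<times> {..<m2}; a2 \<in> seqs (nY1 N) n;
      a3 \<in> seqs (nY2 N) n; b2 < m1; b3 < m2\<rbrakk>
      \<Longrightarrow> (\<Sum>b1\<in>seqs (nX N) n. Z b1 b2 b3 a1 a2 a3) = (\<Sum>b1\<in>seqs (nX N) n. Z b1 b2 b3 a1' a2 a3)"
    and ns_box_Tx: "\<And>a1 a2 a2' a3 a3' b1. \<lbrakk>a1 \<in> {..<m1} \<times> {..<m2}; a2 \<in> seqs (nY1 N) n; a2' \<in> seqs (nY1 N) n;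
      a3 \<in> seqs (nY2 N) n; a3' \<in> seqs (nY2 N) n; b1 \<in> seqs (nX N) n\<rbrakk>
      \<Longrightarrow> (\<Sum>b2<m1. \<Sum>b3<m2. Z b1 b2 b3 a1 a2 a3) = (\<Sum>b2<m1. \<Sum>b3<m2. Z b1 b2 b3 a1 a2' a3')"
    and ns_box_Rx1: "\<And>a1 a1' a2 a3 a3' b2. \<lbrakk>a1 \<in> {..<m1} \<times> {..<m2}; a1' \<in> {..<m1} \<times> {..<m2}; a2 \<in> seqs (nY1 N) n;
      a3 \<in> seqs (nY2 N) n; a3' \<in> seqs (nY2 N) n; b2 < m1\<rbrakk>
      \<Longrightarrow> (\<Sum>b1\<in>seqs (nX N) n. \<Sum>b3<m2. Z b1 b2 b3 a1 a2 a3) = (\<Sum>b1\<in>seqs (nX N) n. \<Sum>b3<m2. Z b1 b2 b3 a1' a2 a3')"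
proof -
  note * = assms[unfolded ns_box_def Let_def]
  show "(\<Sum>b3<m2. Z b1 b2 b3 a1 a2 a3) = (\<Sum>b3<m2. Z b1 b2 b3 a1 a2 a3')"
    if "a1 \<in> {..<m1} \<times> {..<m2}" "a2 \<in> seqs (nY1 N) n" "a3 \<in> seqs (nY2 N) n" "a3' \<in> seqs (nY2 N) n"
      "b1 \<in> seqs (nX N) n" "b2 < m1" for a1 a2 a3 a3' b1 b2
    using *[THEN conjunct1] that by (meson lessThan_iff)
  show "(\<Sum>b2<m1. Z b1 b2 b3 a1 a2 a3) = (\<Sum>b2<m1. Z b1 b2 b3 a1 a2' a3)"
    if "a1 \<in> {..<m1} \<times> {..<m2}" "a2 \<in> seqs (nY1 N) n" "a2' \<in> seqs (nY1 N) n" "a3 \<in> seqs (nY2 N) n"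
      "b1 \<in> seqs (nX N) n" "b3 < m2" for a1 a2 a2' a3 b1 b3
    using *[THEN conjunct2, THEN conjunct1] that by (meson lessThan_iff)
  show "(\<Sum>b1\<in>seqs (nX N) n. Z b1 b2 b3 a1 a2 a3) = (\<Sum>b1\<in>seqs (nX N) n. Z b1 b2 b3 a1' a2 a3)"
    if "a1 \<in> {..<m1} \<times> {..<m2}" "a1' \<in> {..<m1} \<times> {..<m2}" "a2 \<in> seqs (nY1 N) n" "a3 \<in> seqs (nY2 N) n"
      "b2 < m1" "b3 < m2" for a1 a1' a2 a3 b2 b3
    using *[THEN conjunct2, THEN conjunct2, THEN conjunct1] that by (meson lessThan_iff)
  show "(\<Sum>b2<m1. \<Sum>b3<m2. Z b1 b2 b3 a1 a2 a3) = (\<Sum>b2<m1. \<Sum>b3<m2. Z b1 b2 b3 a1 a2' a3')"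
    if "a1 \<in> {..<m1} \<times> {..<m2}" "a2 \<in> seqs (nY1 N) n" "a2' \<in> seqs (nY1 N) n" "a3 \<in> seqs (nY2 N) n"
      "a3' \<in> seqs (nY2 N) n" "b1 \<in> seqs (nX N) n" for a1 a2 a2' a3 a3' b1
    using *[THEN conjunct2, THEN conjunct2, THEN conjunct2, THEN conjunct1] that by meson
  show "(\<Sum>b1\<in>seqs (nX N) n. \<Sum>b3<m2. Z b1 b2 b3 a1 a2 a3) = (\<Sum>b1\<in>seqs (nX N) n. \<Sum>b3<m2. Z b1 b2 b3 a1' a2 a3')"
    if "a1 \<in> {..<m1} \<times> {..<m2}" "a1' \<in> {..<m1} \<times> {..<m2}" "a2 \<in> seqs (nY1 N) n" "a3 \<in> seqs (nY2 N) n"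
      "a3' \<in> seqs (nY2 N) n" "b2 < m1" for a1 a1' a2 a3 a3' b2
    using *[THEN conjunct2, THEN conjunct2, THEN conjunct2, THEN conjunct2, THEN conjunct1] that
    by (meson lessThan_iff)
qed

section \<open>Classical schemes as NS schemes, and their error probabilities\<close>

lemma ns_scheme_nonneg:
  assumes "ns_scheme N n m1 m2 Z" "w1 < m1" "w2 < m2" "ys1 \<in> seqs (nY1 N) n" "ys2 \<in> seqs (nY2 N) n"
    "x \<in> seqs (nX N) n" "b2 < m1" "b3 < m2"
  shows "0 \<le> Z x b2 b3 (w1, w2) ys1 ys2"
  using assms unfolding ns_scheme_def cond_pmf_box_def by auto

text \<open>The box is a product of three local kernels, so summing out the output of one party
  removes the only factor that contains the input of that party.\<close>

lemma classical_imp_ns_scheme: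
  assumes "classical_scheme N n m1 m2 Z"
  shows "ns_scheme N n m1 m2 Z"
proof -
  let ?X = "seqs (nX N) n" and ?Y1 = "seqs (nY1 N) n" and ?Y2 = "seqs (nY2 N) n"
  from assms obtain phi psi1 psi2 where m: "1 \<le> m1" "1 \<le> m2"
    and phi: "\<forall>w\<in>{..<m1} \<times> {..<m2}. (\<forall>x\<in>?X. phi w x \<ge> 0) \<and> (\<Sum>x\<in>?X. phi w x) = 1"
    and psi1: "\<forall>y\<in>?Y1. (\<forall>b<m1. psi1 y b \<ge> 0) \<and> (\<Sum>b<m1. psi1 y b) = 1"
    and psi2: "\<forall>y\<in>?Y2. (\<forall>b<m2. psi2 y b \<ge> 0) \<and> (\<Sum>b<m2. psi2 y b) = 1"
    and Z: "\<forall>w\<in>{..<m1} \<times> {..<m2}. \<forall>y1\<in>?Y1. \<forall>y2\<in>?Y2. \<forall>x\<in>?X. \<forall>b2<m1. \<forall>b3<m2.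
           Z x b2 b3 w y1 y2 = phi w x * psi1 y1 b2 * psi2 y2 b3"
    unfolding classical_scheme_def by blast
  have s3: "(\<Sum>b3<m2. Z x b2 b3 w y1 y2) = phi w x * psi1 y1 b2"
    if "w \<in> {..<m1} \<times> {..<m2}" "y1 \<in> ?Y1" "y2 \<in> ?Y2" "x \<in> ?X" "b2 < m1" for w y1 y2 x b2
  proof -
    have "(\<Sum>b3<m2. Z x b2 b3 w y1 y2) = (\<Sum>b3<m2. phi w x * psi1 y1 b2 * psi2 y2 b3)"
      using Z that by (intro sum.cong refl) auto
    then show ?thesis using psi2 that by (simp flip: sum_distrib_left)
  qed
  have s2: "(\<Sum>b2<m1. Z x b2 b3 w y1 y2) = phi w x * psi2 y2 b3"
    if "w \<in> {..<m1} \<times> {..<m2}" "y1 \<in> ?Y1" "y2 \<in> ?Y2" "x \<in> ?X" "b3 < m2" for w y1 y2 x b3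
  proof -
    have "(\<Sum>b2<m1. Z x b2 b3 w y1 y2) = (\<Sum>b2<m1. phi w x * psi1 y1 b2 * psi2 y2 b3)"
      using Z that by (intro sum.cong refl) auto
    then show ?thesis using psi1 that by (simp flip: sum_distrib_left sum_distrib_right)
  qed
  have s1: "(\<Sum>x\<in>?X. Z x b2 b3 w y1 y2) = psi1 y1 b2 * psi2 y2 b3"
    if "w \<in> {..<m1} \<times> {..<m2}" "y1 \<in> ?Y1" "y2 \<in> ?Y2" "b2 < m1" "b3 < m2" for w y1 y2 b2 b3
  proof -
    have "(\<Sum>x\<in>?X. Z x b2 b3 w y1 y2) = (\<Sum>x\<in>?X. phi w x * psi1 y1 b2 * psi2 y2 b3)"
      using Z that by (intro sum.cong refl) auto
    then show ?thesis using phi that by (simp flip: sum_distrib_left sum_distrib_right)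
  qed
  have "ns_box N n m1 m2 Z"
    by (rule ns_boxI) (simp_all only: s1 s2 s3)
  moreover have "cond_pmf_box N n m1 m2 Z"
    unfolding cond_pmf_box_def
  proof (intro ballI conjI allI impI)
    fix w y1 y2 assume w: "w \<in> {..<m1} \<times> {..<m2}" and y: "y1 \<in> ?Y1" "y2 \<in> ?Y2"
    show "0 \<le> Z x b2 b3 w y1 y2" if "x \<in> ?X" "b2 < m1" "b3 < m2" for x b2 b3
      using Z w y that phi psi1 psi2 by auto
    have "(\<Sum>x\<in>?X. \<Sum>b2<m1. \<Sum>b3<m2. Z x b2 b3 w y1 y2) = (\<Sum>x\<in>?X. \<Sum>b2<m1. phi w x * psi1 y1 b2)"
      using w y by (intro sum.cong refl s3) auto
    also have "\<dots> = (\<Sum>x\<in>?X. phi w x)" using psi1 y by (simp flip: sum_distrib_left)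
    also have "\<dots> = 1" using phi w by blast
    finally show "(\<Sum>x\<in>?X. \<Sum>b2<m1. \<Sum>b3<m2. Z x b2 b3 w y1 y2) = 1" .
  qed
  ultimately show ?thesis using m by (simp add: ns_scheme_def)
qed

text \<open>Box and channel feed each other, so it is no-signalling that makes their product a
  probability law: the marginal of the transmitter ignores \<open>y1\<close> and \<open>y2\<close>,
  hence the channel can be summed out before \<open>x\<close>.\<close>

lemma ns_scheme_total:
  assumes bc: "is_bc N" and ns: "ns_scheme N n m1 m2 Z" and w: "w1 < m1" "w2 < m2"
  shows "(\<Sum>x\<in>seqs (nX N) n. \<Sum>y1\<in>seqs (nY1 N) n. \<Sum>y2\<in>seqs (nY2 N) n.
     \<Sum>b2<m1. \<Sum>b3<m2. Z x b2 b3 (w1, w2) y1 y2 * chanN N x y1 y2) = 1"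
proof -
  let ?X = "seqs (nX N) n" and ?Y1 = "seqs (nY1 N) n" and ?Y2 = "seqs (nY2 N) n"
  define u1 where "u1 = replicate n (0::nat)"
  have u: "u1 \<in> ?Y1" "u1 \<in> ?Y2" using bc by (auto simp: is_bc_def u1_def intro!: replicate_in_seqs)
  have box: "ns_box N n m1 m2 Z" and pmf: "cond_pmf_box N n m1 m2 Z" using ns by (auto simp: ns_scheme_def)
  define T where "T x = (\<Sum>b2<m1. \<Sum>b3<m2. Z x b2 b3 (w1, w2) u1 u1)" for x
  have "(\<Sum>x\<in>?X. \<Sum>y1\<in>?Y1. \<Sum>y2\<in>?Y2. \<Sum>b2<m1. \<Sum>b3<m2. Z x b2 b3 (w1, w2) y1 y2 * chanN N x y1 y2)
      = (\<Sum>x\<in>?X. \<Sum>y1\<in>?Y1. \<Sum>y2\<in>?Y2. T x * chanN N x y1 y2)"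
    unfolding sum_distrib_right[symmetric] T_def
    using w u by (intro sum.cong refl arg_cong2[of _ _ _ _ "(*)"] ns_box_Tx[OF box]) auto
  also have "\<dots> = (\<Sum>x\<in>?X. T x)"
    using sum_chanN[OF bc] by (simp flip: sum_distrib_left)
  also have "\<dots> = 1"
    using pmf w u unfolding cond_pmf_box_def T_def by blast
  finally show ?thesis .
qed

lemma err1_nonneg:
  assumes "is_bc N" "ns_scheme N n m1 m2 Z"
  shows "0 \<le> err1 N n m1 m2 Z"
  unfolding err1_def
  by (intro mult_nonneg_nonneg sum_nonneg ns_scheme_nonneg[OF assms(2)] chanN_nonneg[OF assms(1)]) auto

lemma err1_eq:
  assumes bc: "is_bc N" and ns: "ns_scheme N n m1 m2 Z"
  shows "err1 N n m1 m2 Z = 1 - (1 / (real m1 * real m2)) *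
     (\<Sum>w1<m1. \<Sum>w2<m2. \<Sum>x\<in>seqs (nX N) n. \<Sum>y1\<in>seqs (nY1 N) n. \<Sum>y2\<in>seqs (nY2 N) n.
        \<Sum>b3<m2. Z x w1 b3 (w1, w2) y1 y2 * chanN N x y1 y2)"
proof -
  let ?X = "seqs (nX N) n" and ?Y1 = "seqs (nY1 N) n" and ?Y2 = "seqs (nY2 N) n"
  have m: "m1 \<ge> 1" "m2 \<ge> 1" using ns by (auto simp: ns_scheme_def)
  have "(\<Sum>w1<m1. \<Sum>w2<m2. \<Sum>x\<in>?X. \<Sum>y1\<in>?Y1. \<Sum>y2\<in>?Y2.
        \<Sum>b2\<in>{..<m1} - {w1}. \<Sum>b3<m2. Z x b2 b3 (w1, w2) y1 y2 * chanN N x y1 y2)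
      = (\<Sum>w1<m1. \<Sum>w2<m2. \<Sum>x\<in>?X. \<Sum>y1\<in>?Y1. \<Sum>y2\<in>?Y2.
        (\<Sum>b2<m1. \<Sum>b3<m2. Z x b2 b3 (w1, w2) y1 y2 * chanN N x y1 y2)
        - (\<Sum>b3<m2. Z x w1 b3 (w1, w2) y1 y2 * chanN N x y1 y2))"
    by (intro sum.cong refl) (simp add: sum_diff1)
  also have "\<dots> = (\<Sum>w1<m1. \<Sum>w2<m2. 1 - (\<Sum>x\<in>?X. \<Sum>y1\<in>?Y1. \<Sum>y2\<in>?Y2.
        \<Sum>b3<m2. Z x w1 b3 (w1, w2) y1 y2 * chanN N x y1 y2))"
    using ns_scheme_total[OF bc ns] by (simp add: sum_subtractf)
  also have "\<dots> = real m1 * real m2 - (\<Sum>w1<m1. \<Sum>w2<m2. \<Sum>x\<in>?X. \<Sum>y1\<in>?Y1. \<Sum>y2\<in>?Y2.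
        \<Sum>b3<m2. Z x w1 b3 (w1, w2) y1 y2 * chanN N x y1 y2)"
    by (simp add: sum_subtractf)
  finally show ?thesis
    using m by (simp add: err1_def right_diff_distrib)
qed

text \<open>The union bound for the two error events, multiplied by the number of message
  pairs.\<close>

lemma joint_success_ge:
  assumes bc: "is_bc N" and ns: "ns_scheme N n m1 m2 Z"
  shows "real m1 * real m2 * (1 - err1 N n m1 m2 Z - err2 N n m1 m2 Z) \<le>
     (\<Sum>w1<m1. \<Sum>w2<m2. \<Sum>x\<in>seqs (nX N) n. \<Sum>y1\<in>seqs (nY1 N) n. \<Sum>y2\<in>seqs (nY2 N) n.
        Z x w1 w2 (w1, w2) y1 y2 * chanN N x y1 y2)"
proof -
  let ?X = "seqs (nX N) n" and ?Y1 = "seqs (nY1 N) n" and ?Y2 = "seqs (nY2 N) n"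
  have m: "m1 \<ge> 1" "m2 \<ge> 1" using ns by (auto simp: ns_scheme_def)
  have split: "(\<Sum>b2<m1. \<Sum>b3<m2. t b2 b3) \<le> t w1 w2 + (\<Sum>b2\<in>{..<m1} - {w1}. \<Sum>b3<m2. t b2 b3)
      + (\<Sum>b2<m1. \<Sum>b3\<in>{..<m2} - {w2}. t b2 b3)"
    if w: "w1 < m1" "w2 < m2" and t: "\<And>b2 b3. b2 < m1 \<Longrightarrow> b3 < m2 \<Longrightarrow> 0 \<le> t b2 b3"
    for t :: "nat \<Rightarrow> nat \<Rightarrow> real" and w1 w2
  proof -
    have "(\<Sum>b2<m1. \<Sum>b3<m2. t b2 b3) = (\<Sum>b3<m2. t w1 b3) + (\<Sum>b2\<in>{..<m1} - {w1}. \<Sum>b3<m2. t b2 b3)"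
      using w by (simp add: sum.remove)
    moreover have "(\<Sum>b3<m2. t w1 b3) = t w1 w2 + (\<Sum>b3\<in>{..<m2} - {w2}. t w1 b3)"
      using w by (simp add: sum.remove)
    moreover have "(\<Sum>b3\<in>{..<m2} - {w2}. t w1 b3) \<le> (\<Sum>b2<m1. \<Sum>b3\<in>{..<m2} - {w2}. t b2 b3)"
      using w t by (intro member_le_sum[of w1 "{..<m1}" "\<lambda>b2. \<Sum>b3\<in>{..<m2} - {w2}. t b2 b3"] sum_nonneg) auto
    ultimately show ?thesis by simp
  qed
  have "real m1 * real m2 = (\<Sum>w1<m1. \<Sum>w2<m2. \<Sum>x\<in>?X. \<Sum>y1\<in>?Y1. \<Sum>y2\<in>?Y2.
      \<Sum>b2<m1. \<Sum>b3<m2. Z x b2 b3 (w1, w2) y1 y2 * chanN N x y1 y2)"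
    using ns_scheme_total[OF bc ns] by simp
  also have "\<dots> \<le> (\<Sum>w1<m1. \<Sum>w2<m2. \<Sum>x\<in>?X. \<Sum>y1\<in>?Y1. \<Sum>y2\<in>?Y2.
      Z x w1 w2 (w1, w2) y1 y2 * chanN N x y1 y2
      + (\<Sum>b2\<in>{..<m1} - {w1}. \<Sum>b3<m2. Z x b2 b3 (w1, w2) y1 y2 * chanN N x y1 y2)
      + (\<Sum>b2<m1. \<Sum>b3\<in>{..<m2} - {w2}. Z x b2 b3 (w1, w2) y1 y2 * chanN N x y1 y2))"
    by (intro sum_mono split mult_nonneg_nonneg ns_scheme_nonneg[OF ns] chanN_nonneg[OF bc]) auto
  also have "\<dots> = (\<Sum>w1<m1. \<Sum>w2<m2. \<Sum>x\<in>?X. \<Sum>y1\<in>?Y1. \<Sum>y2\<in>?Y2.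
      Z x w1 w2 (w1, w2) y1 y2 * chanN N x y1 y2)
      + real m1 * real m2 * err1 N n m1 m2 Z + real m1 * real m2 * err2 N n m1 m2 Z"
    using m by (simp add: sum.distrib err1_def err2_def)
  finally show ?thesis by (simp add: algebra_simps)
qed

section \<open>The point-to-point channel to receiver 1\<close>

definition marg_chan :: "bc \<Rightarrow> nat \<Rightarrow> nat list \<Rightarrow> nat list \<Rightarrow> real" where
  "marg_chan N n xs ys1 = (\<Sum>ys2\<in>seqs (nY2 N) n. chanN N xs ys1 ys2)"

lemma marg_chan_nonneg:
  "is_bc N \<Longrightarrow> xs \<in> seqs (nX N) n \<Longrightarrow> ys1 \<in> seqs (nY1 N) n \<Longrightarrow> 0 \<le> marg_chan N n xs ys1"
  unfolding marg_chan_def by (intro sum_nonneg chanN_nonneg)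

lemma sum_marg_chan:
  "is_bc N \<Longrightarrow> xs \<in> seqs (nX N) n \<Longrightarrow> (\<Sum>ys1\<in>seqs (nY1 N) n. marg_chan N n xs ys1) = 1"
  unfolding marg_chan_def by (rule sum_chanN)

text \<open>Averaged over the messages and scaled by \<open>m1\<close>, \<open>p x\<close> is the
  probability that the box emits \<open>x\<close>, and \<open>r x y\<close> the probability that it
  emits \<open>x\<close> while receiver 1, given \<open>y\<close>, outputs the right message.
  Columns of \<open>r\<close> sum to one because the output of receiver 1 cannot depend on the
  messages, so a uniform message is hit with probability \<open>1 / m1\<close>.\<close>

lemma ns_metaconverse:
  assumes bc: "is_bc N" and ns: "ns_scheme N n m1 m2 Z"
  obtains p r where "\<And>x. x \<in> seqs (nX N) n \<Longrightarrow> 0 \<le> p x" "(\<Sum>x\<in>seqs (nX N) n. p x) = real m1"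
    "\<And>x y. x \<in> seqs (nX N) n \<Longrightarrow> y \<in> seqs (nY1 N) n \<Longrightarrow> 0 \<le> r x y"
    "\<And>x y. x \<in> seqs (nX N) n \<Longrightarrow> y \<in> seqs (nY1 N) n \<Longrightarrow> r x y \<le> p x"
    "\<And>y. y \<in> seqs (nY1 N) n \<Longrightarrow> (\<Sum>x\<in>seqs (nX N) n. r x y) = 1"
    "1 - err1 N n m1 m2 Z = (\<Sum>x\<in>seqs (nX N) n. \<Sum>y\<in>seqs (nY1 N) n. marg_chan N n x y * r x y) / real m1"
proof -
  let ?X = "seqs (nX N) n" and ?Y1 = "seqs (nY1 N) n" and ?Y2 = "seqs (nY2 N) n"
  define u where "u = replicate n (0::nat)"
  have u: "u \<in> ?Y1" "u \<in> ?Y2" using bc by (auto simp: is_bc_def u_def intro!: replicate_in_seqs)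
  have m: "m1 \<ge> 1" "m2 \<ge> 1" using ns by (auto simp: ns_scheme_def)
  have box: "ns_box N n m1 m2 Z" and pmf: "cond_pmf_box N n m1 m2 Z" using ns by (auto simp: ns_scheme_def)
  \<comment> \<open>\<open>V\<close> is the box shared by the transmitter and receiver 1; the word
    \<open>u\<close> given to receiver 2 is arbitrary, since no-signalling makes \<open>V\<close>
    independent of it.\<close>
  define V where "V x b w y = (\<Sum>b3<m2. Z x b b3 w y u)" for x b w y
  define p where "p x = (\<Sum>w1<m1. \<Sum>w2<m2. \<Sum>b<m1. V x b (w1, w2) u) / real m2" for x
  define r where "r x y = (\<Sum>w1<m1. \<Sum>w2<m2. V x w1 (w1, w2) y) / real m2" for x y
  have V0: "0 \<le> V x b (w1, w2) y" if "x \<in> ?X" "y \<in> ?Y1" "b < m1" "w1 < m1" "w2 < m2" for x y b w1 w2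
    unfolding V_def using that u by (intro sum_nonneg ns_scheme_nonneg[OF ns]) auto
  have Vu: "(\<Sum>b<m1. V x b (w1, w2) y) = (\<Sum>b<m1. V x b (w1, w2) u)"
    if "x \<in> ?X" "y \<in> ?Y1" "w1 < m1" "w2 < m2" for x y w1 w2
    unfolding V_def using that u by (intro ns_box_Tx[OF box]) auto
  have V1: "(\<Sum>x\<in>?X. \<Sum>b<m1. V x b (w1, w2) y) = 1" if "y \<in> ?Y1" "w1 < m1" "w2 < m2" for y w1 w2
    unfolding V_def using pmf that u unfolding cond_pmf_box_def by blast
  have p0: "0 \<le> p x" if "x \<in> ?X" for x
    unfolding p_def using V0 that u by (intro divide_nonneg_nonneg sum_nonneg) auto
  have p1: "(\<Sum>x\<in>?X. p x) = real m1"
  proof -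
    have "(\<Sum>x\<in>?X. p x) = (\<Sum>w1<m1. \<Sum>w2<m2. \<Sum>x\<in>?X. \<Sum>b<m1. V x b (w1, w2) u) / real m2"
      unfolding p_def by (simp add: sum.swap[of _ ?X] flip: sum_divide_distrib)
    then show ?thesis using V1 u m by simp
  qed
  have r0: "0 \<le> r x y" if "x \<in> ?X" "y \<in> ?Y1" for x y
    unfolding r_def using V0 that by (intro divide_nonneg_nonneg sum_nonneg) auto
  have rp: "r x y \<le> p x" if "x \<in> ?X" "y \<in> ?Y1" for x y
  proof -
    have "V x w1 (w1, w2) y \<le> (\<Sum>b<m1. V x b (w1, w2) u)" if w: "w1 < m1" "w2 < m2" for w1 w2
    proof -
      have "V x w1 (w1, w2) y \<le> (\<Sum>b<m1. V x b (w1, w2) y)"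
        using w V0 \<open>x \<in> ?X\<close> \<open>y \<in> ?Y1\<close> by (intro member_le_sum) auto
      then show ?thesis using Vu[OF \<open>x \<in> ?X\<close> \<open>y \<in> ?Y1\<close> w] by simp
    qed
    then show ?thesis
      unfolding r_def p_def by (intro divide_right_mono sum_mono) auto
  qed
  have r1: "(\<Sum>x\<in>?X. r x y) = 1" if y: "y \<in> ?Y1" for y
  proof -
    have "(\<Sum>x\<in>?X. r x y) = (\<Sum>w1<m1. \<Sum>w2<m2. \<Sum>x\<in>?X. V x w1 (w1, w2) y) / real m2"
      unfolding r_def by (simp add: sum.swap[of _ ?X] flip: sum_divide_distrib)
    \<comment> \<open>With the messages replaced by \<open>(0, 0)\<close>, the sum over right
      answers \<open>w1\<close> runs through all outputs of receiver 1 and becomes a total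
      probability.\<close>
    also have "(\<Sum>w1<m1. \<Sum>w2<m2. \<Sum>x\<in>?X. V x w1 (w1, w2) y) = (\<Sum>w1<m1. \<Sum>w2<m2. \<Sum>x\<in>?X. V x w1 (0, 0) y)"
      unfolding V_def using y u m by (intro sum.cong refl ns_box_Rx1[OF box]) auto
    also have "\<dots> = real m2 * (\<Sum>x\<in>?X. \<Sum>b<m1. V x b (0, 0) y)"
      by (simp add: sum_distrib_left sum.swap[of _ ?X])
    also have "\<dots> = real m2"
      using V1[of y 0 0] y m by simp
    finally show ?thesis using m by simp
  qed
  have "(\<Sum>w1<m1. \<Sum>w2<m2. \<Sum>x\<in>?X. \<Sum>y1\<in>?Y1. \<Sum>y2\<in>?Y2. \<Sum>b3<m2. Z x w1 b3 (w1, w2) y1 y2 * chanN N x y1 y2)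
      = (\<Sum>w1<m1. \<Sum>w2<m2. \<Sum>x\<in>?X. \<Sum>y1\<in>?Y1. \<Sum>y2\<in>?Y2. V x w1 (w1, w2) y1 * chanN N x y1 y2)"
    unfolding V_def sum_distrib_right[symmetric]
    using u by (intro sum.cong refl arg_cong2[of _ _ _ _ "(*)"] ns_box_Tx_Rx1[OF box]) auto
  also have "\<dots> = (\<Sum>w1<m1. \<Sum>w2<m2. \<Sum>x\<in>?X. \<Sum>y1\<in>?Y1. marg_chan N n x y1 * V x w1 (w1, w2) y1)"
    unfolding marg_chan_def sum_distrib_right by (simp add: mult.commute)
  also have "\<dots> = (\<Sum>x\<in>?X. \<Sum>y1\<in>?Y1. \<Sum>w1<m1. \<Sum>w2<m2. marg_chan N n x y1 * V x w1 (w1, w2) y1)"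
    by (simp only: sum.swap[of _ "{..<m2}" ?X] sum.swap[of _ "{..<m2}" ?Y1]
      sum.swap[of _ "{..<m1}" ?X] sum.swap[of _ "{..<m1}" ?Y1])
  also have "\<dots> = real m2 * (\<Sum>x\<in>?X. \<Sum>y\<in>?Y1. marg_chan N n x y * r x y)"
  proof -
    have "(\<Sum>w1<m1. \<Sum>w2<m2. marg_chan N n x y * V x w1 (w1, w2) y) = real m2 * (marg_chan N n x y * r x y)" for x y
      using m by (simp add: r_def flip: sum_distrib_left)
    then show ?thesis by (simp add: sum_distrib_left)
  qed
  finally have "1 - err1 N n m1 m2 Z = (\<Sum>x\<in>?X. \<Sum>y\<in>?Y1. marg_chan N n x y * r x y) / real m1"
    using m by (simp add: err1_eq[OF bc ns])
  with that p0 p1 r0 rp r1 show ?thesis by blast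
qed

text \<open>A crude bound that makes NS rates finite: entries of \<open>r\<close> are at most one
  because its columns sum to one, and each row of the channel sums to one, which leaves the number
  of input words.\<close>

lemma ns_success_le:
  assumes bc: "is_bc N" and ns: "ns_scheme N n m1 m2 Z"
  shows "real m1 * (1 - err1 N n m1 m2 Z) \<le> real (nX N) ^ n"
proof -
  let ?X = "seqs (nX N) n" and ?Y1 = "seqs (nY1 N) n"
  have m: "m1 \<ge> 1" using ns by (auto simp: ns_scheme_def)
  obtain p r where r0: "\<And>x y. x \<in> ?X \<Longrightarrow> y \<in> ?Y1 \<Longrightarrow> 0 \<le> r x y"
    and r1: "\<And>y. y \<in> ?Y1 \<Longrightarrow> (\<Sum>x\<in>?X. r x y) = (1 :: real)"
    and e: "1 - err1 N n m1 m2 Z = (\<Sum>x\<in>?X. \<Sum>y\<in>?Y1. marg_chan N n x y * r x y) / real m1"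
    by (rule ns_metaconverse[OF bc ns]) blast
  have "(\<Sum>x\<in>?X. \<Sum>y\<in>?Y1. marg_chan N n x y * r x y) \<le> (\<Sum>x\<in>?X. \<Sum>y\<in>?Y1. marg_chan N n x y * 1)"
  proof (intro sum_mono mult_left_mono)
    fix x y assume "x \<in> ?X" "y \<in> ?Y1"
    then show "r x y \<le> 1" "0 \<le> marg_chan N n x y"
      using r1[of y] member_le_sum[of x ?X "\<lambda>x. r x y"] r0 marg_chan_nonneg[OF bc] by auto
  qed
  also have "\<dots> = real (nX N) ^ n"
    using sum_marg_chan[OF bc] by (simp add: card_seqs)
  finally show ?thesis using m by (simp add: e)
qed

text \<open>The codebook serves user 1 alone. User 2 has a single message, so its decoder cannot
  err.\<close>

lemma classical_scheme_of_code:
  assumes bc: "is_bc N" and k: "1 \<le> k" and c: "\<And>b. b < k \<Longrightarrow> c b \<in> seqs (nX N) n"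
    and \<psi>: "\<And>y. y \<in> seqs (nY1 N) n \<Longrightarrow> (\<forall>b<k. 0 \<le> \<psi> y b) \<and> (\<Sum>b<k. \<psi> y b) = 1"
  shows "\<exists>Z. classical_scheme N n k 1 Z \<and> err2 N n k 1 Z = 0 \<and>
    err1 N n k 1 Z = 1 - (\<Sum>b<k. \<Sum>y\<in>seqs (nY1 N) n. marg_chan N n (c b) y * \<psi> y b) / real k"
proof -
  let ?X = "seqs (nX N) n" and ?Y1 = "seqs (nY1 N) n" and ?Y2 = "seqs (nY2 N) n"
  define Z :: box where "Z = (\<lambda>x b2 b3 w y1 y2. (if x = c (fst w) then 1 else 0) * \<psi> y1 b2 * 1)"
  have cl: "classical_scheme N n k 1 Z"
    unfolding classical_scheme_def
    using k c \<psi> by (intro conjI exI[of _ "\<lambda>w x. if x = c (fst w) then 1 else 0"] exI[of _ \<psi>] exI[of _ "\<lambda>_ _. 1"])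
      (auto simp: Z_def sum.delta)
  have inner: "(\<Sum>y1\<in>?Y1. \<Sum>y2\<in>?Y2. \<Sum>b3<1. Z x w1 b3 (w1, w2) y1 y2 * chanN N x y1 y2)
      = (if x = c w1 then (\<Sum>y1\<in>?Y1. marg_chan N n (c w1) y1 * \<psi> y1 w1) else 0)" for x w1 w2
    unfolding marg_chan_def sum_distrib_right Z_def by (auto simp: mult.commute)
  have "(\<Sum>w1<k. \<Sum>w2<1. \<Sum>x\<in>?X. \<Sum>y1\<in>?Y1. \<Sum>y2\<in>?Y2. \<Sum>b3<1. Z x w1 b3 (w1, w2) y1 y2 * chanN N x y1 y2)
      = (\<Sum>w1<k. \<Sum>x\<in>?X. if x = c w1 then (\<Sum>y1\<in>?Y1. marg_chan N n (c w1) y1 * \<psi> y1 w1) else 0)"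
    unfolding inner by simp
  also have "\<dots> = (\<Sum>b<k. \<Sum>y\<in>?Y1. marg_chan N n (c b) y * \<psi> y b)"
    using c by (simp add: sum.delta)
  finally have "err1 N n k 1 Z = 1 - (\<Sum>b<k. \<Sum>y\<in>?Y1. marg_chan N n (c b) y * \<psi> y b) / real k"
    unfolding err1_eq[OF bc classical_imp_ns_scheme[OF cl]] by simp
  moreover have "err2 N n k 1 Z = 0"
    unfolding err2_def by (simp add: lessThan_Suc)
  ultimately show ?thesis using cl by blast
qed

text \<open>Random coding with the weights of the NS box: each of the \<open>k - 1\<close> competing
  codewords costs at most a fraction \<open>1 / m1\<close> of the success probability, which is at
  most one, so \<open>\<delta>\<close> bounds the total loss.\<close>

lemma classical_scheme_of_ns:
  assumes bc: "is_bc N" and ns: "ns_scheme N n m1 m2 Z"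
    and k: "1 \<le> k" "real k - 1 \<le> \<delta> * real m1" and \<delta>: "0 \<le> \<delta>"
  shows "\<exists>Z'. classical_scheme N n k 1 Z' \<and> err2 N n k 1 Z' = 0 \<and> err1 N n k 1 Z' \<le> err1 N n m1 m2 Z + \<delta>"
proof -
  let ?X = "seqs (nX N) n" and ?Y1 = "seqs (nY1 N) n"
  have m: "m1 \<ge> 1" using ns by (auto simp: ns_scheme_def)
  define S where "S = 1 - err1 N n m1 m2 Z"
  have S1: "S \<le> 1" using err1_nonneg[OF bc ns] by (simp add: S_def)
  obtain p r where p: "\<And>x. x \<in> ?X \<Longrightarrow> 0 \<le> p x" "(\<Sum>x\<in>?X. p x) = real m1"
    and r: "\<And>x y. x \<in> ?X \<Longrightarrow> y \<in> ?Y1 \<Longrightarrow> 0 \<le> r x y" "\<And>x y. x \<in> ?X \<Longrightarrow> y \<in> ?Y1 \<Longrightarrow> r x y \<le> p x"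
    and r1: "\<And>y. y \<in> ?Y1 \<Longrightarrow> (\<Sum>x\<in>?X. r x y) = (1 :: real)"
    and e: "S = (\<Sum>x\<in>?X. \<Sum>y\<in>?Y1. marg_chan N n x y * r x y) / real m1"
    unfolding S_def by (rule ns_metaconverse[OF bc ns]) blast
  have S0: "0 \<le> S"
    unfolding e by (intro divide_nonneg_nonneg sum_nonneg mult_nonneg_nonneg marg_chan_nonneg[OF bc] r(1)) auto
  obtain c \<psi> where c: "\<forall>b<k. c b \<in> ?X" and \<psi>: "\<forall>y\<in>?Y1. (\<forall>b<k. 0 \<le> \<psi> y b) \<and> (\<Sum>b<k. \<psi> y b) = 1"
    and ge: "real k * (1 - (real k - 1) / real m1) * S \<le> (\<Sum>b<k. \<Sum>y\<in>?Y1. marg_chan N n (c b) y * \<psi> y b)"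
    using random_code[of ?X ?Y1 k "real m1" "marg_chan N n" r p] m k(1) marg_chan_nonneg[OF bc] r p r1
    unfolding e by auto
  obtain Z' where Z': "classical_scheme N n k 1 Z'" "err2 N n k 1 Z' = 0"
    and e1: "err1 N n k 1 Z' = 1 - (\<Sum>b<k. \<Sum>y\<in>?Y1. marg_chan N n (c b) y * \<psi> y b) / real k"
    using classical_scheme_of_code[OF bc k(1), of c n \<psi>] c \<psi> by blast
  have "(1 - (real k - 1) / real m1) * S \<le> (\<Sum>b<k. \<Sum>y\<in>?Y1. marg_chan N n (c b) y * \<psi> y b) / real k"
    using ge k(1) by (simp add: pos_le_divide_eq mult_ac)
  moreover have "(real k - 1) / real m1 \<le> \<delta>"
    using k(2) m by (simp add: pos_divide_le_eq)
  then have "(real k - 1) / real m1 * S \<le> \<delta> * 1"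
    using S0 S1 \<delta> by (intro mult_mono) auto
  ultimately have "err1 N n k 1 Z' \<le> err1 N n m1 m2 Z + \<delta>"
    unfolding e1 by (simp add: S_def algebra_simps)
  with Z' show ?thesis by blast
qed

section \<open>Rates and the factor two\<close>

definition swap_bc :: "bc \<Rightarrow> bc" where
  "swap_bc N = \<lparr>nX = nX N, nY1 = nY2 N, nY2 = nY1 N, W = (\<lambda>x y1 y2. W N x y2 y1)\<rparr>"

definition swap_box :: "box \<Rightarrow> box" where
  "swap_box Z = (\<lambda>x b2 b3 w y1 y2. Z x b3 b2 (prod.swap w) y2 y1)"

lemma swap_bc_simps [simp]:
  "nX (swap_bc N) = nX N" "nY1 (swap_bc N) = nY2 N" "nY2 (swap_bc N) = nY1 N"
  "W (swap_bc N) x y1 y2 = W N x y2 y1"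
  by (simp_all add: swap_bc_def)

lemma swap_bc_swap_bc [simp]: "swap_bc (swap_bc N) = N"
  by (simp add: swap_bc_def)

lemma is_bc_swap: "is_bc N \<Longrightarrow> is_bc (swap_bc N)"
  by (auto simp: is_bc_def sum.swap[of _ "{..<nY2 N}" "{..<nY1 N}"])

lemma chanN_swap [simp]: "chanN (swap_bc N) xs ys1 ys2 = chanN N xs ys2 ys1"
  by (simp add: chanN_def)

lemma err1_swap: "err1 (swap_bc N) n m2 m1 (swap_box Z) = err2 N n m1 m2 Z"
proof -
  have "err1 (swap_bc N) n m2 m1 (swap_box Z) = (1 / (real m1 * real m2)) *
     (\<Sum>w1<m1. \<Sum>w2<m2. \<Sum>x\<in>seqs (nX N) n. \<Sum>y2\<in>seqs (nY2 N) n. \<Sum>y1\<in>seqs (nY1 N) n.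
        \<Sum>b3\<in>{..<m2} - {w2}. \<Sum>b2<m1. Z x b2 b3 (w1, w2) y1 y2 * chanN N x y1 y2)"
    unfolding err1_def by (subst sum.swap) (simp add: swap_box_def mult.commute)
  then show ?thesis
    unfolding err2_def
    by (simp only: sum.swap[of _ "{..<m2} - {_}" "{..<m1}"] sum.swap[of _ "seqs (nY2 N) n" "seqs (nY1 N) n"])
qed

lemma swap_box_swap_box [simp]: "swap_box (swap_box Z) = Z"
  by (simp add: swap_box_def fun_eq_iff)

lemma err2_swap: "err2 (swap_bc N) n m2 m1 (swap_box Z) = err1 N n m1 m2 Z"
  using err1_swap[of "swap_bc N" n m1 m2 "swap_box Z"] by simp

lemma ns_scheme_swap:
  assumes "ns_scheme N n m1 m2 Z"
  shows "ns_scheme (swap_bc N) n m2 m1 (swap_box Z)"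
proof -
  have box: "ns_box N n m1 m2 Z" and pmf: "cond_pmf_box N n m1 m2 Z" and m: "m1 \<ge> 1" "m2 \<ge> 1"
    using assms by (auto simp: ns_scheme_def)
  have "ns_box (swap_bc N) n m2 m1 (swap_box Z)"
    by (rule ns_boxI; simp only: swap_box_def swap_bc_simps;
        rule ns_box_Tx_Rx1[OF box] ns_box_Tx_Rx2[OF box] ns_box_Rx1_Rx2[OF box]; force)
  moreover have "cond_pmf_box (swap_bc N) n m2 m1 (swap_box Z)"
    unfolding cond_pmf_box_def
  proof (intro ballI conjI allI impI; unfold swap_bc_simps)
    fix w y1 y2 assume w: "w \<in> {..<m2} \<times> {..<m1}" and y: "y1 \<in> seqs (nY2 N) n" "y2 \<in> seqs (nY1 N) n"
    then have w': "prod.swap w \<in> {..<m1} \<times> {..<m2}" by auto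
    show "0 \<le> swap_box Z x b2 b3 w y1 y2" if "x \<in> seqs (nX N) n" "b2 < m2" "b3 < m1" for x b2 b3
      using ns_scheme_nonneg[OF assms, of "snd w" "fst w" y2 y1 x b3 b2] w y that
      by (auto simp: swap_box_def prod.swap_def)
    have "(\<Sum>x\<in>seqs (nX N) n. \<Sum>b3<m1. \<Sum>b2<m2. Z x b3 b2 (prod.swap w) y2 y1) = 1"
      using bspec[OF pmf[unfolded cond_pmf_box_def] w'] y by blast
    then show "(\<Sum>x\<in>seqs (nX N) n. \<Sum>b2<m2. \<Sum>b3<m1. swap_box Z x b2 b3 w y1 y2) = 1"
      unfolding swap_box_def by (simp only: sum.swap[of _ "{..<m2}" "{..<m1}"])
  qed
  ultimately show ?thesis using m by (simp add: ns_scheme_def)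
qed

lemma classical_scheme_swap:
  assumes "classical_scheme N n m1 m2 Z"
  shows "classical_scheme (swap_bc N) n m2 m1 (swap_box Z)"
proof -
  from assms obtain phi psi1 psi2 where m: "1 \<le> m1" "1 \<le> m2"
    and phi: "\<forall>w\<in>{..<m1} \<times> {..<m2}. (\<forall>x\<in>seqs (nX N) n. phi w x \<ge> 0) \<and> (\<Sum>x\<in>seqs (nX N) n. phi w x) = 1"
    and psi: "\<forall>y\<in>seqs (nY1 N) n. (\<forall>b<m1. psi1 y b \<ge> 0) \<and> (\<Sum>b<m1. psi1 y b) = 1"
      "\<forall>y\<in>seqs (nY2 N) n. (\<forall>b<m2. psi2 y b \<ge> 0) \<and> (\<Sum>b<m2. psi2 y b) = 1"
    and Z: "\<forall>w\<in>{..<m1} \<times> {..<m2}. \<forall>y1\<in>seqs (nY1 N) n. \<forall>y2\<in>seqs (nY2 N) n.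
         \<forall>x\<in>seqs (nX N) n. \<forall>b2<m1. \<forall>b3<m2. Z x b2 b3 w y1 y2 = phi w x * psi1 y1 b2 * psi2 y2 b3"
    unfolding classical_scheme_def by blast
  show ?thesis
    unfolding classical_scheme_def swap_bc_simps swap_box_def
    using m phi psi Z
    by (intro conjI exI[of _ "\<lambda>w. phi (prod.swap w)"] exI[of _ psi2] exI[of _ psi1]) auto
qed

lemma achievable_swap:
  assumes "achievable P N R"
    and P: "\<And>n m1 m2 Z. P N n m1 m2 Z \<Longrightarrow> P (swap_bc N) n m2 m1 (swap_box Z)"
  shows "achievable P (swap_bc N) (prod.swap R)"
proof -
  from assms(1) obtain m1 m2 Z where 1: "\<forall>n. P N n (m1 n) (m2 n) (Z n)"
    and 2: "(\<lambda>n. max (err1 N n (m1 n) (m2 n) (Z n)) (err2 N n (m1 n) (m2 n) (Z n))) \<longlonglongrightarrow> 0"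
    and 3: "\<exists>L1. (\<lambda>n. log 2 (real (m1 n)) / real n) \<longlonglongrightarrow> L1 \<and> L1 \<ge> fst R"
      "\<exists>L2. (\<lambda>n. log 2 (real (m2 n)) / real n) \<longlonglongrightarrow> L2 \<and> L2 \<ge> snd R"
    unfolding achievable_def by blast
  show ?thesis
    unfolding achievable_def
    by (rule exI[of _ m2], rule exI[of _ m1], rule exI[of _ "\<lambda>n. swap_box (Z n)"])
      (use 1 2 3 P in \<open>auto simp: err1_swap err2_swap max.commute\<close>)
qed

section \<open>Limits of rates and the passage from NS to classical rates\<close>

lemma rate_limit_le:
  fixes m :: "nat \<Rightarrow> real"
  assumes lim: "(\<lambda>n. log 2 (m n) / real n) \<longlonglongrightarrow> L" and pos: "\<And>n. 0 < m n"
    and le: "\<forall>\<^sub>F n in sequentially. m n \<le> K * B ^ n" and KB: "0 < K" "0 < B"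
  shows "L \<le> log 2 B"
proof (rule tendsto_le[OF sequentially_bot _ lim])
  \<comment> \<open>The constant factor \<open>K\<close> changes the rate by
    \<open>log 2 K / n\<close>, which vanishes.\<close>
  have "(\<lambda>n. log 2 K / real n + log 2 B) \<longlonglongrightarrow> 0 + log 2 B"
    by (intro tendsto_add tendsto_const tendsto_divide_0 filterlim_compose[OF tendsto_const]
        tendsto_divide_0[OF tendsto_const] filterlim_real_at_infinity_sequentially)
  then show "(\<lambda>n. log 2 K / real n + log 2 B) \<longlonglongrightarrow> log 2 B" by simp
  show "\<forall>\<^sub>F n in sequentially. log 2 (m n) / real n \<le> log 2 K / real n + log 2 B"
    using le eventually_gt_at_top[of 0]
  proof eventually_elim
    case (elim n)
    have "log 2 (m n) \<le> log 2 (K * B ^ n)"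
      using elim pos KB by (intro log_mono) auto
    also have "\<dots> = log 2 K + real n * log 2 B"
      using KB by (simp add: log_mult log_nat_power)
    finally have "log 2 (m n) / real n \<le> (log 2 K + real n * log 2 B) / real n"
      by (intro divide_right_mono) auto
    also have "\<dots> = log 2 K / real n + log 2 B"
      using elim(2) by (simp add: add_divide_distrib)
    finally show ?case .
  qed
qed

lemma achievable_ns_fst_le:
  assumes bc: "is_bc N" and ach: "achievable ns_scheme N R"
  shows "fst R \<le> log 2 (nX N)"
proof -
  from ach obtain m1 m2 Z L1 where ns: "\<And>n. ns_scheme N n (m1 n) (m2 n) (Z n)"
    and err: "(\<lambda>n. max (err1 N n (m1 n) (m2 n) (Z n)) (err2 N n (m1 n) (m2 n) (Z n))) \<longlonglongrightarrow> 0"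
    and L: "(\<lambda>n. log 2 (real (m1 n)) / real n) \<longlonglongrightarrow> L1" "fst R \<le> L1"
    unfolding achievable_def by blast
  have m: "m1 n \<ge> 1" for n using ns[of n] by (auto simp: ns_scheme_def)
  have "\<forall>\<^sub>F n in sequentially. max (err1 N n (m1 n) (m2 n) (Z n)) (err2 N n (m1 n) (m2 n) (Z n)) < 1/2"
    using err by (rule order_tendstoD) simp
  then have "\<forall>\<^sub>F n in sequentially. real (m1 n) \<le> 2 * real (nX N) ^ n"
  proof eventually_elim
    case (elim n)
    have "real (m1 n) * (1/2) \<le> real (m1 n) * (1 - err1 N n (m1 n) (m2 n) (Z n))"
      using elim by (intro mult_left_mono) auto
    also have "\<dots> \<le> real (nX N) ^ n" by (rule ns_success_le[OF bc ns])
    finally show ?case by simp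
  qed
  then have "L1 \<le> log 2 (nX N)"
    using L(1) m bc by (intro rate_limit_le[of "\<lambda>n. real (m1 n)" L1 2]) (auto simp: is_bc_def Suc_le_eq)
  with L(2) show ?thesis by simp
qed

lemma achievable_ns_snd_le:
  assumes "is_bc N" "achievable ns_scheme N R"
  shows "snd R \<le> log 2 (nX N)"
  using achievable_ns_fst_le[OF is_bc_swap achievable_swap[OF assms(2) ns_scheme_swap]] assms(1) by simp

lemma achievable_classical_imp_ns: "achievable classical_scheme N R \<Longrightarrow> achievable ns_scheme N R"
  unfolding achievable_def by (meson classical_imp_ns_scheme)

text \<open>Thinning the messages of user 1 by a factor that grows only linearly in \<open>n\<close>
  sends the additional error to zero and leaves the limit of the rate unchanged.\<close>

lemma classical_achievable_of_ns_fst: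
  assumes bc: "is_bc N" and ach: "achievable ns_scheme N R"
  shows "achievable classical_scheme N (fst R, 0)"
proof -
  from ach obtain m1 m2 Z L1 where ns: "\<And>n. ns_scheme N n (m1 n) (m2 n) (Z n)"
    and err: "(\<lambda>n. max (err1 N n (m1 n) (m2 n) (Z n)) (err2 N n (m1 n) (m2 n) (Z n))) \<longlonglongrightarrow> 0"
    and L: "(\<lambda>n. log 2 (real (m1 n)) / real n) \<longlonglongrightarrow> L1" "fst R \<le> L1"
    unfolding achievable_def by blast
  have m: "m1 n \<ge> 1" for n using ns[of n] by (auto simp: ns_scheme_def)
  \<comment> \<open>\<open>max 1\<close> keeps one message when \<open>m1 n \<le> n\<close>; in that
    case \<open>k n - 1 = 0\<close>, so the bound \<open>k2\<close> still holds.\<close>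
  define k where "k n = max 1 (m1 n div (n + 1))" for n
  have k1: "1 \<le> k n" for n by (simp add: k_def)
  have k2: "real (k n) - 1 \<le> 1 / real (n + 1) * real (m1 n)" for n
  proof (cases "m1 n div (n + 1) \<le> 1")
    case False
    then have "real (k n) = real (m1 n div (n + 1))" by (simp add: k_def)
    also have "\<dots> \<le> real (m1 n) / real (n + 1)" by (rule of_nat_div_le_of_nat)
    finally show ?thesis by simp
  qed (simp add: k_def)
  have k_le: "k n \<le> m1 n" for n
    using m[of n] by (simp add: k_def)
  have k_ge: "m1 n \<le> 2 * (n + 1) * k n" for n
  proof -
    have "m1 n < (n + 1) * (m1 n div (n + 1)) + (n + 1)"
      using mult_div_mod_eq[of "n + 1" "m1 n"] mod_less_divisor[of "n + 1" "m1 n"] by linarith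
    moreover have "(n + 1) * (m1 n div (n + 1)) \<le> (n + 1) * k n"
      by (intro mult_le_mono2) (simp add: k_def)
    moreover have "n + 1 \<le> (n + 1) * k n"
      using mult_le_mono2[OF k1[of n], of "n + 1"] by simp
    ultimately show ?thesis by simp
  qed
  have "\<forall>n. \<exists>Z'. classical_scheme N n (k n) 1 Z' \<and> err2 N n (k n) 1 Z' = 0
      \<and> err1 N n (k n) 1 Z' \<le> err1 N n (m1 n) (m2 n) (Z n) + 1 / real (n + 1)"
    using classical_scheme_of_ns[OF bc ns k1 k2] by auto
  then obtain Z' where cl: "\<And>n. classical_scheme N n (k n) 1 (Z' n)"
    and e2: "\<And>n. err2 N n (k n) 1 (Z' n) = 0"
    and e1: "\<And>n. err1 N n (k n) 1 (Z' n) \<le> err1 N n (m1 n) (m2 n) (Z n) + 1 / real (n + 1)"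
    by metis
  have "(\<lambda>n. max (err1 N n (k n) 1 (Z' n)) (err2 N n (k n) 1 (Z' n))) \<longlonglongrightarrow> 0"
  proof (rule tendsto_sandwich[where f = "\<lambda>_. 0"])
    show "(\<lambda>n. max (err1 N n (m1 n) (m2 n) (Z n)) (err2 N n (m1 n) (m2 n) (Z n)) + inverse (real (Suc n))) \<longlonglongrightarrow> 0"
      using tendsto_add[OF err LIMSEQ_inverse_real_of_nat] by simp
    show "\<forall>\<^sub>F n in sequentially. max (err1 N n (k n) 1 (Z' n)) (err2 N n (k n) 1 (Z' n))
        \<le> max (err1 N n (m1 n) (m2 n) (Z n)) (err2 N n (m1 n) (m2 n) (Z n)) + inverse (real (Suc n))"
    proof (intro always_eventually allI)
      fix n
      have "0 \<le> err1 N n (m1 n) (m2 n) (Z n)" by (rule err1_nonneg[OF bc ns])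
      moreover have "0 \<le> inverse (real (Suc n))" by simp
      ultimately show "max (err1 N n (k n) 1 (Z' n)) (err2 N n (k n) 1 (Z' n))
        \<le> max (err1 N n (m1 n) (m2 n) (Z n)) (err2 N n (m1 n) (m2 n) (Z n)) + inverse (real (Suc n))"
        using e1[of n] e2[of n] by (simp add: inverse_eq_divide del: of_nat_Suc)
    qed
  qed (auto simp: e2[simplified])
  moreover have "(\<lambda>n. log 2 (real (k n)) / real n) \<longlonglongrightarrow> L1"
  proof (rule tendsto_sandwich)
    \<comment> \<open>This is \<open>log 2 (4 * n) / n\<close>, an upper bound for the rate lost by
      thinning, since \<open>m1 n \<le> 4 * n * k n\<close> for positive \<open>n\<close>.\<close>
    have "(\<lambda>n. 2 / real n + ln (real n) / real n / ln 2) \<longlonglongrightarrow> 0 + 0 / ln 2"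
      by (intro tendsto_intros lim_ln_over_n tendsto_divide_0[OF tendsto_const]
          filterlim_real_at_infinity_sequentially) auto
    then show "(\<lambda>n. log 2 (real (m1 n)) / real n - (2 / real n + ln (real n) / real n / ln 2)) \<longlonglongrightarrow> L1"
      using tendsto_diff[OF L(1)] by fastforce
    show "\<forall>\<^sub>F n in sequentially. log 2 (real (m1 n)) / real n - (2 / real n + ln (real n) / real n / ln 2)
        \<le> log 2 (real (k n)) / real n"
      using eventually_gt_at_top[of 0]
    proof eventually_elim
      case (elim n)
      have "2 * (n + 1) \<le> 4 * n" using elim by simp
      then have "m1 n \<le> 4 * n * k n" by (rule order_trans[OF k_ge mult_le_mono1])
      then have "real (m1 n) \<le> 4 * real n * real (k n)"
        by (metis of_nat_le_iff of_nat_mult of_nat_numeral)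
      then have "log 2 (real (m1 n)) \<le> log 2 (4 * real n * real (k n))"
        using m[of n] by (intro log_mono) auto
      also have "\<dots> = 2 + ln (real n) / ln 2 + log 2 (real (k n))"
        using elim k1[of n] log_nat_power[of 2 2 2] by (simp add: log_mult) (simp add: log_def)
      finally have "log 2 (real (m1 n)) / real n \<le> (2 + ln (real n) / ln 2 + log 2 (real (k n))) / real n"
        by (intro divide_right_mono) auto
      then show ?case by (simp add: add_divide_distrib mult.commute)
    qed
    show "\<forall>\<^sub>F n in sequentially. log 2 (real (k n)) / real n \<le> log 2 (real (m1 n)) / real n"
    proof (intro always_eventually allI divide_right_mono log_mono)
      show "0 < real (k n)" "real (k n) \<le> real (m1 n)" for n
        using k1[of n] k_le[of n] by auto
    qed auto
  qed (rule L(1))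
  ultimately show ?thesis
    unfolding achievable_def using cl L(2)
    by (intro exI[of _ k] exI[of _ "\<lambda>_. 1"] exI[of _ Z']) auto
qed

lemma classical_achievable_of_ns_snd:
  assumes "is_bc N" "achievable ns_scheme N R"
  shows "achievable classical_scheme N (0, snd R)"
  using achievable_swap[OF classical_achievable_of_ns_fst[OF is_bc_swap
      achievable_swap[OF assms(2) ns_scheme_swap]] classical_scheme_swap] assms(1)
  by simp

section \<open>Bounds on sum-capacities from achievable pairs\<close>

lemma achievable_classical_zero:
  assumes bc: "is_bc N"
  shows "achievable classical_scheme N (0, 0)"
proof -
  have "replicate n 0 \<in> seqs (nX N) n" for n
    using bc by (auto simp: is_bc_def intro!: replicate_in_seqs)
  then have "\<exists>Z. classical_scheme N n 1 1 Z" for n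
    using classical_scheme_of_code[OF bc, of 1 "\<lambda>_. replicate n 0" n "\<lambda>_ _. 1"] by auto
  then obtain Z where "\<And>n. classical_scheme N n 1 1 (Z n)" by metis
  moreover have "err1 N n 1 1 (Z n) = 0" "err2 N n 1 1 (Z n) = 0" for n
    by (simp_all add: err1_def err2_def lessThan_Suc)
  ultimately show ?thesis
    unfolding achievable_def
    by (intro exI[of _ "\<lambda>_. 1"] exI[of _ Z]) auto
qed

text \<open>The half-plane is closed, so the bound passes from achievable pairs to their closure;
  the pair \<open>R0\<close> makes the set under the supremum nonempty.\<close>

lemma sum_cap_le:
  assumes "achievable P N R0" and B: "\<And>R. achievable P N R \<Longrightarrow> fst R + snd R \<le> B"
  shows "sum_cap P N \<le> B"
proof -
  have "closed {R :: real \<times> real. fst R + snd R \<le> B}"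
    by (intro closed_Collect_le continuous_intros)
  then have "cap_region P N \<subseteq> {R. fst R + snd R \<le> B}"
    unfolding cap_region_def using B by (intro closure_minimal) auto
  moreover have "R0 \<in> cap_region P N"
    unfolding cap_region_def using assms(1) closure_subset by blast
  ultimately show ?thesis
    unfolding sum_cap_def by (intro cSup_least) auto
qed

text \<open>The bound \<open>B\<close> extends to the closure and makes the set of sum rates bounded
  above, so that \<open>Sup\<close> dominates its members.\<close>

lemma le_sum_cap:
  assumes ach: "achievable P N R" and B: "\<And>R. achievable P N R \<Longrightarrow> fst R + snd R \<le> B"
  shows "fst R + snd R \<le> sum_cap P N"
proof -
  have "closed {R :: real \<times> real. fst R + snd R \<le> B}"
    by (intro closed_Collect_le continuous_intros)
  then have "cap_region P N \<subseteq> {R. fst R + snd R \<le> B}"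
    unfolding cap_region_def using B by (intro closure_minimal) auto
  then have "bdd_above ((\<lambda>R. fst R + snd R) ` cap_region P N)"
    by (intro bdd_aboveI[of _ B]) auto
  moreover have "R \<in> cap_region P N"
    unfolding cap_region_def using ach closure_subset by blast
  ultimately show ?thesis
    unfolding sum_cap_def by (intro cSup_upper) auto
qed

lemma le_sum_cap_ns:
  assumes "is_bc N" "achievable ns_scheme N R"
  shows "fst R + snd R \<le> sum_cap ns_scheme N"
  using assms(2)
  by (rule le_sum_cap[where B = "log 2 (nX N) + log 2 (nX N)"])
    (intro add_mono achievable_ns_fst_le achievable_ns_snd_le assms(1))

lemma le_sum_cap_classical:
  assumes "is_bc N" "achievable classical_scheme N R"
  shows "fst R + snd R \<le> sum_cap classical_scheme N"
  using assms(2)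
  by (rule le_sum_cap[where B = "log 2 (nX N) + log 2 (nX N)"])
    (intro add_mono achievable_ns_fst_le achievable_ns_snd_le achievable_classical_imp_ns assms(1))

text \<open>For an NS-achievable \<open>R\<close>, both \<open>(fst R, 0)\<close> and
  \<open>(0, snd R)\<close> are classically achievable, so each coordinate is at most the classical
  sum-capacity.\<close>

lemma sum_cap_ns_le:
  assumes bc: "is_bc N"
  shows "sum_cap ns_scheme N \<le> 2 * sum_cap classical_scheme N"
proof (rule sum_cap_le)
  show "achievable ns_scheme N (0, 0)"
    by (rule achievable_classical_imp_ns[OF achievable_classical_zero[OF bc]])
  fix R assume R: "achievable ns_scheme N R"
  show "fst R + snd R \<le> 2 * sum_cap classical_scheme N"
    using le_sum_cap_classical[OF bc classical_achievable_of_ns_fst[OF bc R]]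
      le_sum_cap_classical[OF bc classical_achievable_of_ns_snd[OF bc R]] by simp
qed

section \<open>A channel with nearly doubled sum-capacity\<close>

lemma chanN_semidet:
  assumes x: "xs \<in> seqs (nX N) n" and y: "ys1 \<in> seqs (nY1 N) n" "ys2 \<in> seqs (nY2 N) n"
    and W: "\<And>x y1 y2. x < nX N \<Longrightarrow> y1 < nY1 N \<Longrightarrow> y2 < nY2 N \<Longrightarrow> W N x y1 y2 = (if y1 = f x then P x y2 else 0)"
  shows "chanN N xs ys1 ys2 = (if ys1 = map f xs then \<Prod>i<n. P (xs ! i) (ys2 ! i) else 0)"
proof -
  have "chanN N xs ys1 ys2 = (\<Prod>i<n. if ys1 ! i = f (xs ! i) then P (xs ! i) (ys2 ! i) else 0)"
    unfolding chanN_eq[OF x] using x y by (intro prod.cong refl W) (auto simp: seqs_nth)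
  moreover have "ys1 = map f xs \<longleftrightarrow> (\<forall>i<n. ys1 ! i = f (xs ! i))"
    using x y by (auto simp: list_eq_iff_nth_eq seqs_length)
  ultimately show ?thesis by (cases "ys1 = map f xs") auto
qed

text \<open>Channel law and collision bound factorise over positions, so
  \<open>one_shot_converse\<close> applies to words with \<open>\<kappa> ^ n\<close> in place of
  \<open>\<kappa>\<close>. The quarter of the message pairs in its bound moves to the left side and
  turns \<open>1\<close> into \<open>3 / 4\<close>.\<close>

lemma semidet_classical_converse:
  assumes bc: "is_bc N"
    and W: "\<And>x y1 y2. x < nX N \<Longrightarrow> y1 < nY1 N \<Longrightarrow> y2 < nY2 N \<Longrightarrow> W N x y1 y2 = (if y1 = f x then P x y2 else 0)"
    and f: "\<And>x. x < nX N \<Longrightarrow> f x < nY1 N"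
    and P: "\<And>x y. x < nX N \<Longrightarrow> y < nY2 N \<Longrightarrow> 0 \<le> P x y"
    and c: "\<And>x x'. x < nX N \<Longrightarrow> x' < nX N \<Longrightarrow> (\<Sum>y<nY2 N. P x y * P x' y) \<le> c (f x) (f x')"
      "\<And>z z'. 0 \<le> c z z'" "\<And>z. z < nY1 N \<Longrightarrow> (\<Sum>z'<nY1 N. c z z') \<le> \<kappa>"
    and \<kappa>: "0 < \<kappa>"
    and cl: "classical_scheme N n m1 m2 Z"
  shows "real m1 * real m2 * (3 / 4 - err1 N n m1 m2 Z - err2 N n m1 m2 Z) \<le> (real (nY2 N) * \<kappa>) ^ n"
proof -
  let ?X = "seqs (nX N) n" and ?Y1 = "seqs (nY1 N) n" and ?Y2 = "seqs (nY2 N) n"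
  from cl obtain phi psi1 psi2
    where phi: "\<forall>w\<in>{..<m1} \<times> {..<m2}. (\<forall>x\<in>?X. phi w x \<ge> 0) \<and> (\<Sum>x\<in>?X. phi w x) = 1"
    and psi1: "\<forall>y\<in>?Y1. (\<forall>b<m1. psi1 y b \<ge> 0) \<and> (\<Sum>b<m1. psi1 y b) = 1"
    and psi2: "\<forall>y\<in>?Y2. (\<forall>b<m2. psi2 y b \<ge> 0) \<and> (\<Sum>b<m2. psi2 y b) = 1"
    and Z: "\<forall>w\<in>{..<m1} \<times> {..<m2}. \<forall>y1\<in>?Y1. \<forall>y2\<in>?Y2. \<forall>x\<in>?X. \<forall>b2<m1. \<forall>b3<m2.
           Z x b2 b3 w y1 y2 = phi w x * psi1 y1 b2 * psi2 y2 b3"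
    unfolding classical_scheme_def by blast
  define Pn where "Pn x y = (\<Prod>i<n. P (x ! i) (y ! i))" for x y
  define cn where "cn z z' = (\<Prod>i<n. c (z ! i) (z' ! i))" for z z'
  have fX: "map f x \<in> ?Y1" if "x \<in> ?X" for x
    using that f by (auto simp: seqs_def)
  have "real m1 * real m2 * (1 - err1 N n m1 m2 Z - err2 N n m1 m2 Z)
      \<le> (\<Sum>w1<m1. \<Sum>w2<m2. \<Sum>x\<in>?X. \<Sum>y1\<in>?Y1. \<Sum>y2\<in>?Y2. Z x w1 w2 (w1, w2) y1 y2 * chanN N x y1 y2)"
    by (rule joint_success_ge[OF bc classical_imp_ns_scheme[OF cl]])
  also have "\<dots> = (\<Sum>w1<m1. \<Sum>w2<m2. \<Sum>x\<in>?X. \<Sum>y2\<in>?Y2. phi (w1, w2) x * psi1 (map f x) w1 * psi2 y2 w2 * Pn x y2)"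
  proof (rule sum.cong[OF refl], rule sum.cong[OF refl], rule sum.cong[OF refl])
    fix w1 w2 x assume w: "w1 \<in> {..<m1}" "w2 \<in> {..<m2}" and x: "x \<in> ?X"
    have "(\<Sum>y1\<in>?Y1. \<Sum>y2\<in>?Y2. Z x w1 w2 (w1, w2) y1 y2 * chanN N x y1 y2)
        = (\<Sum>y1\<in>?Y1. if y1 = map f x then \<Sum>y2\<in>?Y2. phi (w1, w2) x * psi1 (map f x) w1 * psi2 y2 w2 * Pn x y2 else 0)"
    proof (intro sum.cong refl)
      fix y1 assume y1: "y1 \<in> ?Y1"
      have "(\<Sum>y2\<in>?Y2. Z x w1 w2 (w1, w2) y1 y2 * chanN N x y1 y2)
          = (\<Sum>y2\<in>?Y2. phi (w1, w2) x * psi1 y1 w1 * psi2 y2 w2 * (if y1 = map f x then Pn x y2 else 0))"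
        unfolding Pn_def using w x y1 Z
        by (intro sum.cong refl arg_cong2[of _ _ _ _ "(*)"] chanN_semidet W) auto
      then show "(\<Sum>y2\<in>?Y2. Z x w1 w2 (w1, w2) y1 y2 * chanN N x y1 y2)
          = (if y1 = map f x then \<Sum>y2\<in>?Y2. phi (w1, w2) x * psi1 (map f x) w1 * psi2 y2 w2 * Pn x y2 else 0)"
        by auto
    qed
    then show "(\<Sum>y1\<in>?Y1. \<Sum>y2\<in>?Y2. Z x w1 w2 (w1, w2) y1 y2 * chanN N x y1 y2)
        = (\<Sum>y2\<in>?Y2. phi (w1, w2) x * psi1 (map f x) w1 * psi2 y2 w2 * Pn x y2)"
      using fX[OF x] by (simp add: sum.delta)
  qed
  also have "\<dots> \<le> real (card ?Y2) * \<kappa> ^ n + real (card {..<m1}) * real (card {..<m2}) / 4"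
  proof (rule one_shot_converse[where Z = ?Y1 and c = cn and phi = "\<lambda>w1 w2. phi (w1, w2)"
        and h = psi1 and g = psi2 and P = Pn and f = "map f"])
    show "(\<Sum>y\<in>?Y2. Pn x y * Pn x' y) \<le> cn (map f x) (map f x')" if x: "x \<in> ?X" "x' \<in> ?X" for x x'
    proof -
      have "(\<Sum>y\<in>?Y2. Pn x y * Pn x' y) = (\<Prod>i<n. \<Sum>y<nY2 N. P (x ! i) y * P (x' ! i) y)"
        using sum_seqs_prod[of "\<lambda>i y. P (x ! i) y * P (x' ! i) y" n "nY2 N"]
        by (simp add: Pn_def prod.distrib)
      also have "\<dots> \<le> (\<Prod>i<n. c (f (x ! i)) (f (x' ! i)))"
        using x P c(1) by (intro prod_mono) (auto simp: seqs_nth intro!: sum_nonneg)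
      also have "\<dots> = cn (map f x) (map f x')"
        using x by (simp add: cn_def seqs_length)
      finally show ?thesis .
    qed
    show "0 \<le> cn z z'" for z z'
      using c(2) by (simp add: cn_def prod_nonneg)
    show "(\<Sum>z'\<in>?Y1. cn z z') \<le> \<kappa> ^ n" if z: "z \<in> ?Y1" for z
    proof -
      have "(\<Sum>z'\<in>?Y1. cn z z') = (\<Prod>i<n. \<Sum>z'<nY1 N. c (z ! i) z')"
        unfolding cn_def by (rule sum_seqs_prod[of "\<lambda>i. c (z ! i)"])
      also have "\<dots> \<le> (\<Prod>i<n. \<kappa>)"
        using z c(2,3) by (intro prod_mono) (auto simp: seqs_nth intro!: sum_nonneg)
      finally show ?thesis by simp
    qed
    show "0 \<le> Pn x y" if "x \<in> ?X" "y \<in> ?Y2" for x y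
      unfolding Pn_def using that P by (intro prod_nonneg) (auto simp: seqs_nth)
  qed (use phi psi1 psi2 fX \<kappa> in auto)
  also have "\<dots> = (real (nY2 N) * \<kappa>) ^ n + real m1 * real m2 / 4"
    by (simp add: card_seqs power_mult_distrib)
  finally show ?thesis by (simp add: algebra_simps)
qed

section \<open>Pairs of residues and linear congruences modulo \<open>q\<close>\<close>

lemma sum_lessThan_mult:
  fixes g :: "nat \<Rightarrow> nat \<Rightarrow> 'a :: comm_monoid_add"
  shows "(\<Sum>y<p * q. g (y div q) (y mod q)) = (\<Sum>s<p. \<Sum>t<q. g s t)"
proof (cases "q = 0")
  case False
  have bound: "s * q + t < p * q" if "s < p" "t < q" for s t
  proof -
    have "s * q + t < Suc s * q" using that by simp
    also have "\<dots> \<le> p * q" using that by (intro mult_le_mono1) simp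
    finally show ?thesis .
  qed
  show ?thesis
    unfolding sum.cartesian_product
    by (rule sum.reindex_bij_witness[of _ "\<lambda>(s, t). s * q + t" "\<lambda>y. (y div q, y mod q)"])
      (use False in \<open>auto simp: less_mult_imp_div_less bound\<close>)
qed simp

lemma mod_add_eq_iff:
  fixes b k l q :: nat
  assumes "b < q"
  shows "(b + k) mod q = l mod q \<longleftrightarrow> b = nat ((int l - int k) mod int q)"
proof -
  have "(b + k) mod q = l mod q \<longleftrightarrow> (int b + int k) mod int q = int l mod int q"
    by (metis of_nat_add of_nat_eq_iff of_nat_mod)
  also have "\<dots> \<longleftrightarrow> int b mod int q = (int l - int k) mod int q"
    by (simp add: mod_eq_dvd_iff algebra_simps)
  also have "\<dots> \<longleftrightarrow> b = nat ((int l - int k) mod int q)"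
    using assms by auto
  finally show ?thesis .
qed

text \<open>The congruence has exactly one solution below \<open>q\<close>, whatever
  \<open>k\<close> and \<open>l\<close> are.\<close>

lemma sum_if_mod_add_eq:
  fixes a :: real and k l q :: nat
  assumes "0 < q"
  shows "(\<Sum>b<q. if (b + k) mod q = l mod q then a else 0) = a"
proof -
  define b0 where "b0 = nat ((int l - int k) mod int q)"
  have "b0 < q" using assms by (simp add: b0_def nat_less_iff)
  moreover have "(\<Sum>b<q. if (b + k) mod q = l mod q then a else 0) = (\<Sum>b<q. if b = b0 then a else 0)"
    by (intro sum.cong refl) (simp add: mod_add_eq_iff b0_def)
  ultimately show ?thesis by simp
qed

text \<open>The input encodes \<open>(x1, x2)\<close> as \<open>x1 * q + x2\<close>; the second output encodes in the same way
  the pair \<open>(s, x2 + s * x1)\<close> over the integers modulo \<open>q\<close>, with \<open>s\<close> uniform.\<close>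

definition line_law :: "nat \<Rightarrow> nat \<Rightarrow> nat \<Rightarrow> real" where
  "line_law q x y = (if (x mod q + y div q * (x div q)) mod q = y mod q then 1 / real q else 0)"

definition line_bc :: "nat \<Rightarrow> bc" where
  "line_bc q = \<lparr>nX = q * q, nY1 = q, nY2 = q * q,
     W = (\<lambda>x y1 y2. if y1 = x div q then line_law q x y2 else 0)\<rparr>"

lemma line_bc_simps [simp]:
  "nX (line_bc q) = q * q" "nY1 (line_bc q) = q" "nY2 (line_bc q) = q * q"
  "W (line_bc q) x y1 y2 = (if y1 = x div q then line_law q x y2 else 0)"
  by (simp_all add: line_bc_def)

section \<open>The line channel and its classical sum-capacity\<close>

lemma sum_line_law:
  assumes "0 < q"
  shows "(\<Sum>y<q * q. line_law q x y) = 1"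
proof -
  have "(\<Sum>y<q * q. line_law q x y)
      = (\<Sum>s<q. \<Sum>t<q. if (x mod q + s * (x div q)) mod q = t then 1 / real q else 0)"
    unfolding line_law_def by (rule sum_lessThan_mult)
  then show ?thesis using assms by (simp add: sum.delta)
qed

lemma marg1_line_bc: "0 < q \<Longrightarrow> marg1 (line_bc q) x y1 = (if y1 = x div q then 1 else 0)"
  by (simp add: marg1_def sum_line_law)

lemma is_bc_line_bc:
  assumes "0 < q"
  shows "is_bc (line_bc q)"
proof -
  have "(\<Sum>y1<q. marg1 (line_bc q) x y1) = 1" if "x < q * q" for x
    using that assms by (simp add: marg1_line_bc less_mult_imp_div_less)
  then show ?thesis
    using assms unfolding is_bc_def marg1_def by (simp add: Suc_le_eq line_law_def)
qed

lemma semidet_line_bc: "0 < q \<Longrightarrow> semidet (line_bc q)"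
  unfolding semidet_def by (simp add: is_bc_line_bc marg1_line_bc)

text \<open>Every slope at which the two outputs can agree contributes \<open>1 / q\<^sup>2\<close>.
  Inputs with the same first coordinate agree for at most \<open>q\<close> slopes; with different
  first coordinates the slope solves a nondegenerate linear equation over a field, so at most one
  qualifies.\<close>

lemma line_law_collision:
  assumes q: "prime q" and x: "x < q * q" "x' < q * q"
  shows "(\<Sum>y<q * q. line_law q x y * line_law q x' y)
      \<le> (if x div q = x' div q then 1 / real q else 1 / (real q)\<^sup>2)"
proof -
  have q0: "0 < q" using q prime_gt_0_nat by blast
  define T where "T x s = (x mod q + s * (x div q)) mod q" for x s
  define C where "C = {s. s < q \<and> T x s = T x' s}"
  have "(\<Sum>y<q * q. line_law q x y * line_law q x' y)
      = (\<Sum>s<q. \<Sum>t<q. (if T x s = t then 1 / real q else 0) * (if T x' s = t then 1 / real q else 0))"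
    unfolding line_law_def T_def by (rule sum_lessThan_mult)
  also have "\<dots> = (\<Sum>s<q. if T x s = T x' s then 1 / (real q)\<^sup>2 else 0)"
  proof (intro sum.cong refl)
    fix s
    have "(\<Sum>t<q. (if T x s = t then 1 / real q else 0) * (if T x' s = t then 1 / real q else 0))
        = (\<Sum>t<q. if T x s = t then (if T x' s = t then 1 / (real q)\<^sup>2 else 0) else 0)"
      by (intro sum.cong) (auto simp: power2_eq_square)
    then show "(\<Sum>t<q. (if T x s = t then 1 / real q else 0) * (if T x' s = t then 1 / real q else 0))
        = (if T x s = T x' s then 1 / (real q)\<^sup>2 else 0)"
      using q0 by (auto simp: sum.delta T_def)
  qed
  also have "\<dots> = real (card C) / (real q)\<^sup>2"
    by (simp add: sum.If_cases C_def Int_def lessThan_def)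
  finally have eq: "(\<Sum>y<q * q. line_law q x y * line_law q x' y) = real (card C) / (real q)\<^sup>2" .
  show ?thesis
  proof (cases "x div q = x' div q")
    case True
    have "card C \<le> card {..<q}" unfolding C_def by (intro card_mono) auto
    then have "real (card C) / (real q)\<^sup>2 \<le> real q / (real q)\<^sup>2"
      by (intro divide_right_mono) auto
    then show ?thesis using True eq q0 by (simp add: power2_eq_square)
  next
    case False
    have "s = s'" if "s \<in> C" "s' \<in> C" for s s'
    proof -
      have dvd: "int q dvd (int (x mod q) + int s * int (x div q)) - (int (x' mod q) + int s * int (x' div q))"
        if "s \<in> C" for s
        using that unfolding C_def T_def mem_Collect_eq
        by (metis mod_eq_dvd_iff of_nat_add of_nat_mod of_nat_mult)
      \<comment> \<open>Subtracting the congruences for \<open>s\<close> and \<open>s'\<close>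
        cancels the second coordinates; primality of \<open>q\<close> then separates the two
        factors.\<close>
      have "int q dvd (int s - int s') * (int (x div q) - int (x' div q))"
        using dvd_diff[OF dvd[OF \<open>s \<in> C\<close>] dvd[OF \<open>s' \<in> C\<close>]] by (simp add: algebra_simps)
      then have "int q dvd int s - int s' \<or> int q dvd int (x div q) - int (x' div q)"
        using q by (simp add: prime_dvd_mult_iff)
      moreover have "a = b" if "int q dvd int a - int b" "a < q" "b < q" for a b
        using that by (metis int_ops(1) mod_eq_dvd_iff mod_less of_nat_eq_iff of_nat_mod)
      moreover have "x div q < q" "x' div q < q" using x by (simp_all add: less_mult_imp_div_less)
      ultimately show "s = s'" using False \<open>s \<in> C\<close> \<open>s' \<in> C\<close> unfolding C_def by blast
    qed
    then have "card C \<le> 1"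
      using card_le_Suc0_iff_eq[of C] by (auto simp: C_def)
    then have "real (card C) / (real q)\<^sup>2 \<le> 1 / (real q)\<^sup>2"
      by (intro divide_right_mono) auto
    then show ?thesis using False eq by simp
  qed
qed

text \<open>The collision bound sums to at most \<open>\<kappa> = 2 / q\<close>: one diagonal term
  \<open>1 / q\<close> and at most \<open>q\<close> terms \<open>1 / q\<^sup>2\<close>. With
  \<open>q * q\<close> second outputs the base is \<open>q * q * (2 / q) = 2 * q\<close>.\<close>

lemma line_bc_classical_converse:
  assumes q: "prime q" and cl: "classical_scheme (line_bc q) n m1 m2 Z"
  shows "real m1 * real m2 * (3 / 4 - err1 (line_bc q) n m1 m2 Z - err2 (line_bc q) n m1 m2 Z) \<le> (2 * real q) ^ n"
proof -
  have q0: "0 < q" using q prime_gt_0_nat by blast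
  define c :: "nat \<Rightarrow> nat \<Rightarrow> real" where "c z z' = (if z = z' then 1 / real q else 1 / (real q)\<^sup>2)" for z z'
  have csum: "(\<Sum>z'<q. c z z') \<le> 2 / real q" if "z < q" for z
  proof -
    have "(\<Sum>z'<q. c z z') \<le> (\<Sum>z'<q. (if z = z' then 1 / real q else 0) + 1 / (real q)\<^sup>2)"
      by (intro sum_mono) (auto simp: c_def)
    also have "\<dots> = 2 / real q"
      using that q0 by (simp add: sum.distrib sum.delta power2_eq_square)
    finally show ?thesis .
  qed
  have "real m1 * real m2 * (3 / 4 - err1 (line_bc q) n m1 m2 Z - err2 (line_bc q) n m1 m2 Z)
      \<le> (real (nY2 (line_bc q)) * (2 / real q)) ^ n"
    by (rule semidet_classical_converse[OF is_bc_line_bc[OF q0], where P = "line_law q" and f = "\<lambda>x. x div q" and c = c])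
      (use q0 csum line_law_collision[OF q] cl in \<open>auto simp: c_def line_law_def less_mult_imp_div_less\<close>)
  then show ?thesis using q0 by (simp add: mult.commute)
qed

lemma line_bc_sum_cap_classical_le:
  assumes q: "prime q"
  shows "sum_cap classical_scheme (line_bc q) \<le> 1 + log 2 (real q)"
proof (rule sum_cap_le)
  have q0: "0 < q" using q prime_gt_0_nat by blast
  show "achievable classical_scheme (line_bc q) (0, 0)"
    by (rule achievable_classical_zero[OF is_bc_line_bc[OF q0]])
  fix R assume "achievable classical_scheme (line_bc q) R"
  then obtain m1 m2 Z L1 L2 where cl: "\<And>n. classical_scheme (line_bc q) n (m1 n) (m2 n) (Z n)"
    and err: "(\<lambda>n. max (err1 (line_bc q) n (m1 n) (m2 n) (Z n)) (err2 (line_bc q) n (m1 n) (m2 n) (Z n))) \<longlonglongrightarrow> 0"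
    and L: "(\<lambda>n. log 2 (real (m1 n)) / real n) \<longlonglongrightarrow> L1" "fst R \<le> L1"
      "(\<lambda>n. log 2 (real (m2 n)) / real n) \<longlonglongrightarrow> L2" "snd R \<le> L2"
    unfolding achievable_def by blast
  have m: "0 < m1 n" "0 < m2 n" for n
    using cl[of n] by (auto simp: classical_scheme_def)
  \<comment> \<open>Two errors below \<open>1 / 8\<close> leave at least \<open>1 / 2\<close> of the
    \<open>3 / 4\<close> in the converse.\<close>
  have "\<forall>\<^sub>F n in sequentially. max (err1 (line_bc q) n (m1 n) (m2 n) (Z n)) (err2 (line_bc q) n (m1 n) (m2 n) (Z n)) < 1/8"
    using err by (rule order_tendstoD) simp
  then have ev: "\<forall>\<^sub>F n in sequentially. real (m1 n) * real (m2 n) \<le> 2 * (2 * real q) ^ n"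
  proof eventually_elim
    case (elim n)
    have "real (m1 n) * real (m2 n) * (1/2) \<le> real (m1 n) * real (m2 n) *
        (3 / 4 - err1 (line_bc q) n (m1 n) (m2 n) (Z n) - err2 (line_bc q) n (m1 n) (m2 n) (Z n))"
      using elim by (intro mult_left_mono) auto
    also have "\<dots> \<le> (2 * real q) ^ n" by (rule line_bc_classical_converse[OF q cl])
    finally show ?case by simp
  qed
  have "(\<lambda>n. log 2 (real (m1 n) * real (m2 n)) / real n) \<longlonglongrightarrow> L1 + L2"
    using tendsto_add[OF L(1,3)] m by (simp add: log_mult add_divide_distrib)
  then have "L1 + L2 \<le> log 2 (2 * real q)"
    by (rule rate_limit_le[OF _ _ ev]) (use m q0 in auto)
  also have "\<dots> = 1 + log 2 (real q)" using q0 by (simp add: log_mult)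
  finally show "fst R + snd R \<le> 1 + log 2 (real q)" using L by simp
qed

text \<open>A zero-error box: letter by letter, the receivers output \<open>w1 + y1 - x1\<close> and
  \<open>w2 + t - (x2 + s * x1)\<close> while \<open>(x1, x2)\<close> is uniform; \<open>A\<close> and \<open>B\<close> are the two factors of
  its law.\<close>

lemma line_bc_ns_scheme:
  assumes q: "0 < q"
  shows "\<exists>Z. ns_scheme (line_bc q) n (q ^ n) (q ^ n) Z \<and>
    err1 (line_bc q) n (q ^ n) (q ^ n) Z = 0 \<and> err2 (line_bc q) n (q ^ n) (q ^ n) Z = 0"
proof -
  let ?m = "q ^ n" and ?D = "seqs q n" and ?X = "seqs (q * q) n"
  \<comment> \<open>Messages are read as words of \<open>n\<close> residues through an arbitrary
    bijection; distinct messages then differ in some position.\<close>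
  obtain dig where dig: "bij_betw dig {..<?m} ?D"
    using ex_bij_betw_nat_finite[OF finite_seqs[of q n]] by (auto simp: card_seqs atLeast0LessThan)
  have digD: "dig b \<in> ?D" if "b < ?m" for b
    using dig that by (auto simp: bij_betw_def)
  define A where "A x b w y = (if (b + x div q) mod q = (w + y) mod q then 1 / real q else 0)" for x b w y :: nat
  define B where "B x b w y = (if (b + (x mod q + y div q * (x div q))) mod q = (w + y mod q) mod q
      then 1 / real q else 0)" for x b w y :: nat
  define An where "An x b w y = (\<Prod>i<n. A (x ! i) (dig b ! i) (dig w ! i) (y ! i))" for x b w y
  define Bn where "Bn x b w y = (\<Prod>i<n. B (x ! i) (dig b ! i) (dig w ! i) (y ! i))" for x b w y
  define Z :: box where "Z = (\<lambda>x b2 b3 w y1 y2. An x b2 (fst w) y1 * Bn x b3 (snd w) y2)"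
  have sumA: "(\<Sum>b<?m. An x b w y) = (1 / real q) ^ n" for x w y
  proof -
    have "(\<Sum>b<?m. An x b w y) = (\<Sum>d\<in>?D. \<Prod>i<n. A (x ! i) (d ! i) (dig w ! i) (y ! i))"
      unfolding An_def by (rule sum.reindex_bij_betw[OF dig])
    also have "\<dots> = (\<Prod>i<n. \<Sum>b<q. A (x ! i) b (dig w ! i) (y ! i))"
      by (rule sum_seqs_prod[of "\<lambda>i b. A (x ! i) b (dig w ! i) (y ! i)"])
    finally show ?thesis using q by (simp add: A_def sum_if_mod_add_eq)
  qed
  have sumB: "(\<Sum>b<?m. Bn x b w y) = (1 / real q) ^ n" for x w y
  proof -
    have "(\<Sum>b<?m. Bn x b w y) = (\<Sum>d\<in>?D. \<Prod>i<n. B (x ! i) (d ! i) (dig w ! i) (y ! i))"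
      unfolding Bn_def by (rule sum.reindex_bij_betw[OF dig])
    also have "\<dots> = (\<Prod>i<n. \<Sum>b<q. B (x ! i) b (dig w ! i) (y ! i))"
      by (rule sum_seqs_prod[of "\<lambda>i b. B (x ! i) b (dig w ! i) (y ! i)"])
    finally show ?thesis using q by (simp add: B_def sum_if_mod_add_eq)
  qed
  \<comment> \<open>The first congruence fixes \<open>x1\<close>, and then the second fixes
    \<open>x2\<close>, so exactly one letter survives. The result is the same for all messages,
    which is no-signalling from the transmitter to the two receivers jointly.\<close>
  have sumAB: "(\<Sum>x<q * q. A x b2 w1 y1 * B x b3 w2 y2) = 1 / real q * (1 / real q)" for b2 w1 y1 b3 w2 y2
  proof -
    have "(\<Sum>x<q * q. A x b2 w1 y1 * B x b3 w2 y2)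
      = (\<Sum>s<q. \<Sum>t<q. (if (b2 + s) mod q = (w1 + y1) mod q then 1 / real q else 0) *
          (if (b3 + (t + y2 div q * s)) mod q = (w2 + y2 mod q) mod q then 1 / real q else 0))"
      unfolding A_def B_def by (rule sum_lessThan_mult)
    also have "\<dots> = (\<Sum>s<q. (if (s + b2) mod q = (w1 + y1) mod q then 1 / real q else 0) *
        (\<Sum>t<q. if (t + (b3 + y2 div q * s)) mod q = (w2 + y2 mod q) mod q then 1 / real q else 0))"
      unfolding sum_distrib_left by (simp add: add_ac)
    also have "\<dots> = 1 / real q * (1 / real q)"
      using q by (simp only: sum_if_mod_add_eq flip: sum_distrib_right)
    finally show ?thesis .
  qed
  have sumX: "(\<Sum>x\<in>?X. An x b2 w1 y1 * Bn x b3 w2 y2) = (1 / real q * (1 / real q)) ^ n" for b2 w1 y1 b3 w2 y2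
  proof -
    have "(\<Sum>x\<in>?X. An x b2 w1 y1 * Bn x b3 w2 y2)
      = (\<Prod>i<n. \<Sum>x<q * q. A x (dig b2 ! i) (dig w1 ! i) (y1 ! i) * B x (dig b3 ! i) (dig w2 ! i) (y2 ! i))"
      unfolding An_def Bn_def prod.distrib[symmetric]
      by (rule sum_seqs_prod[of "\<lambda>i x. A x (dig b2 ! i) (dig w1 ! i) (y1 ! i) * B x (dig b3 ! i) (dig w2 ! i) (y2 ! i)"])
    then show ?thesis by (simp only: sumAB) simp
  qed
  have "ns_box (line_bc q) n ?m ?m Z"
    by (rule ns_boxI) (simp_all only: Z_def sumA sumB sumX line_bc_simps flip: sum_distrib_left sum_distrib_right)
  moreover have "cond_pmf_box (line_bc q) n ?m ?m Z"
    unfolding cond_pmf_box_def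
  proof (intro ballI conjI allI impI; unfold line_bc_simps)
    fix w y1 y2
    show "0 \<le> Z x b2 b3 w y1 y2" for x b2 b3
      unfolding Z_def An_def Bn_def A_def B_def by (intro mult_nonneg_nonneg prod_nonneg) auto
    have "(\<Sum>x\<in>?X. \<Sum>b2<?m. \<Sum>b3<?m. Z x b2 b3 w y1 y2) = real ((q * q) ^ n) * ((1 / real q) ^ n * (1 / real q) ^ n)"
      by (simp only: Z_def sumA sumB sum_constant card_seqs flip: sum_distrib_left sum_distrib_right)
    also have "\<dots> = 1"
      using q by (simp add: power_mult_distrib power_divide)
    finally show "(\<Sum>x\<in>?X. \<Sum>b2<?m. \<Sum>b3<?m. Z x b2 b3 w y1 y2) = 1" .
  qed
  ultimately have ns: "ns_scheme (line_bc q) n ?m ?m Z"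
    using q by (simp add: ns_scheme_def Suc_le_eq)
  have chan: "chanN (line_bc q) x y1 y2 = (if y1 = map (\<lambda>x. x div q) x then \<Prod>i<n. line_law q (x ! i) (y2 ! i) else 0)"
    if "x \<in> ?X" "y1 \<in> ?D" "y2 \<in> ?X" for x y1 y2
    using that by (intro chanN_semidet) auto
  have cancel: "a = b" if "(a + k) mod q = (b + k) mod q" "a < q" "b < q" for a b k :: nat
    using that by (simp add: mod_add_eq_iff)
  have diff: "\<exists>i<n. dig b ! i \<noteq> dig w ! i" if "b < ?m" "w < ?m" "b \<noteq> w" for b w
  proof -
    have "dig b \<noteq> dig w"
      using dig that by (auto simp: bij_betw_def dest: inj_onD)
    then show ?thesis
      using digD[OF that(1)] digD[OF that(2)] by (auto simp: list_eq_iff_nth_eq seqs_length)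
  qed
  \<comment> \<open>On the support of the channel \<open>y1\<close> equals the mask
    \<open>x1\<close>, so the mask cancels in \<open>A\<close> and a wrong digit gets weight
    zero.\<close>
  have zero1: "Z x b2 b3 (w1, w2) y1 y2 * chanN (line_bc q) x y1 y2 = 0"
    if xy: "x \<in> ?X" "y1 \<in> ?D" "y2 \<in> ?X" and b: "b2 < ?m" "w1 < ?m" "b2 \<noteq> w1" for x b2 b3 w1 w2 y1 y2
  proof (cases "y1 = map (\<lambda>x. x div q) x")
    case True
    obtain i where i: "i < n" "dig b2 ! i \<noteq> dig w1 ! i" using diff b by blast
    moreover have "dig b2 ! i < q" "dig w1 ! i < q"
      using seqs_nth[OF digD i(1)] b by auto
    ultimately have "A (x ! i) (dig b2 ! i) (dig w1 ! i) (y1 ! i) = 0"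
      using cancel[of "dig b2 ! i" "x ! i div q" "dig w1 ! i"] xy True
      by (auto simp: A_def seqs_nth seqs_length)
    then have "An x b2 w1 y1 = 0" unfolding An_def using i by (intro prod_zero) auto
    then show ?thesis by (simp add: Z_def)
  qed (simp add: chan xy)
  \<comment> \<open>In a position where the digits differ, either the channel excludes
    \<open>y2\<close>, or the mask in \<open>B\<close> agrees with the received residue and cancels,
    excluding the wrong digit.\<close>
  have zero2: "Z x b2 b3 (w1, w2) y1 y2 * chanN (line_bc q) x y1 y2 = 0"
    if xy: "x \<in> ?X" "y1 \<in> ?D" "y2 \<in> ?X" and b: "b3 < ?m" "w2 < ?m" "b3 \<noteq> w2" for x b2 b3 w1 w2 y1 y2
  proof -
    obtain i where i: "i < n" "dig b3 ! i \<noteq> dig w2 ! i" using diff b by blast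
    have "B (x ! i) (dig b3 ! i) (dig w2 ! i) (y2 ! i) = 0 \<or> line_law q (x ! i) (y2 ! i) = 0"
    proof (cases "(x ! i mod q + y2 ! i div q * (x ! i div q)) mod q = y2 ! i mod q")
      case True
      then have "(dig w2 ! i + y2 ! i mod q) mod q
          = (dig w2 ! i + (x ! i mod q + y2 ! i div q * (x ! i div q))) mod q"
        by (metis mod_add_right_eq)
      moreover have "dig b3 ! i < q" "dig w2 ! i < q"
        using seqs_nth[OF digD i(1)] b by auto
      ultimately show ?thesis
        using i cancel[of "dig b3 ! i" "x ! i mod q + y2 ! i div q * (x ! i div q)" "dig w2 ! i"]
        by (auto simp: B_def)
    qed (simp add: line_law_def)
    then have "Bn x b3 w2 y2 = 0 \<or> chanN (line_bc q) x y1 y2 = 0"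
      unfolding Bn_def chan[OF xy] using i by (auto intro!: prod_zero)
    then show ?thesis by (auto simp: Z_def)
  qed
  have "err1 (line_bc q) n ?m ?m Z = 0"
    unfolding err1_def line_bc_simps mult_eq_0_iff
    by (intro disjI2 sum.neutral ballI zero1) auto
  moreover have "err2 (line_bc q) n ?m ?m Z = 0"
    unfolding err2_def line_bc_simps mult_eq_0_iff
    by (intro disjI2 sum.neutral ballI zero2) auto
  ultimately show ?thesis using ns by blast
qed

section \<open>NS sum-capacity of the line channel and the supremum of the ratios\<close>

lemma line_bc_sum_cap_ns_ge:
  assumes q: "0 < q"
  shows "2 * log 2 (real q) \<le> sum_cap ns_scheme (line_bc q)"
proof -
  obtain Z where Z: "\<And>n. ns_scheme (line_bc q) n (q ^ n) (q ^ n) (Z n)"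
    "\<And>n. err1 (line_bc q) n (q ^ n) (q ^ n) (Z n) = 0" "\<And>n. err2 (line_bc q) n (q ^ n) (q ^ n) (Z n) = 0"
    using line_bc_ns_scheme[OF q] by metis
  have "\<forall>\<^sub>F n in sequentially. log 2 (real (q ^ n)) / real n = log 2 (real q)"
    using eventually_gt_at_top[of 0] by eventually_elim (use q in \<open>simp add: log_nat_power\<close>)
  then have "(\<lambda>n. log 2 (real (q ^ n)) / real n) \<longlonglongrightarrow> log 2 (real q)"
    by (rule tendsto_eventually)
  then have "achievable ns_scheme (line_bc q) (log 2 (real q), log 2 (real q))"
    unfolding achievable_def using Z
    by (intro exI[of _ "\<lambda>n. q ^ n"] exI[of _ Z]) auto
  from le_sum_cap_ns[OF is_bc_line_bc[OF q] this] show ?thesis by simp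
qed

text \<open>Positivity of the classical sum-capacity excludes quotients \<open>0 / 0\<close>: by
  \<open>sum_cap_ns_le\<close>, a channel whose classical value vanishes has vanishing NS value
  too.\<close>

theorem theorem3:
  shows "(SUP N \<in> {N. semidet N \<and> sum_cap classical_scheme N > 0}.
            ereal (sum_cap ns_scheme N / sum_cap classical_scheme N)) = 2"
proof (rule antisym)
  show "(SUP N \<in> {N. semidet N \<and> sum_cap classical_scheme N > 0}.
            ereal (sum_cap ns_scheme N / sum_cap classical_scheme N)) \<le> 2"
  proof (rule SUP_least)
    fix N assume "N \<in> {N. semidet N \<and> sum_cap classical_scheme N > 0}"
    then have "is_bc N" "sum_cap classical_scheme N > 0" by (auto simp: semidet_def)
    then have "sum_cap ns_scheme N / sum_cap classical_scheme N \<le> 2"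
      using sum_cap_ns_le[of N] by (simp add: pos_divide_le_eq)
    then show "ereal (sum_cap ns_scheme N / sum_cap classical_scheme N) \<le> 2"
      by (metis ereal_less_eq(3) numeral_eq_ereal)
  qed
next
  let ?S = "SUP N \<in> {N. semidet N \<and> sum_cap classical_scheme N > 0}.
            ereal (sum_cap ns_scheme N / sum_cap classical_scheme N)"
  show "2 \<le> ?S"
  proof (rule ereal_le_epsilon2)
    fix e :: real assume e: "0 < e"
    \<comment> \<open>The size of \<open>q\<close> gives \<open>log 2 q \<ge> 2 / e\<close>; with
      \<open>l = log 2 q\<close> the ratio is then at least
      \<open>2 * l / (1 + l) = 2 - 2 / (1 + l) \<ge> 2 - e\<close>.\<close>
    obtain q :: nat where q: "prime q" "q > 2 ^ nat \<lceil>2 / e\<rceil>"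
      using bigger_prime by blast
    have q0: "0 < q" using q(1) prime_gt_0_nat by blast
    define l where "l = log 2 (real q)"
    define ns where "ns = sum_cap ns_scheme (line_bc q)"
    define cl where "cl = sum_cap classical_scheme (line_bc q)"
    have "log 2 (2 ^ nat \<lceil>2 / e\<rceil>) \<le> l"
      unfolding l_def using q(2) by (intro log_mono) (auto simp flip: of_nat_less_numeral_power_cancel_iff)
    then have "real (nat \<lceil>2 / e\<rceil>) \<le> l" by (simp add: log_nat_power)
    then have le: "2 / e \<le> l" by linarith
    then have l: "0 < l" using e by (smt (verit) divide_pos_pos)
    have b: "2 * l \<le> ns" "ns \<le> 2 * cl" "cl \<le> 1 + l"
      using line_bc_sum_cap_ns_ge[OF q0] sum_cap_ns_le[OF is_bc_line_bc[OF q0]]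
        line_bc_sum_cap_classical_le[OF q(1)]
      by (simp_all add: l_def ns_def cl_def)
    have cl0: "0 < cl" using b l by simp
    have "2 \<le> (2 + l * e) * 1" using le e l by simp
    then have "(2 - e) * (1 + l) \<le> 2 * l"
      using le e by (simp add: pos_divide_le_eq algebra_simps)
    then have "2 - e \<le> 2 * l / (1 + l)" using l by (simp add: pos_le_divide_eq)
    also have "\<dots> \<le> ns / cl" using b cl0 l by (intro frac_le) auto
    finally have "ereal 2 \<le> ereal (ns / cl) + ereal e" by simp
    also have "ereal (ns / cl) \<le> ?S"
      unfolding ns_def cl_def using semidet_line_bc[OF q0] cl0 by (intro SUP_upper) (simp add: cl_def)
    finally show "2 \<le> ?S + ereal e" by (simp add: add_right_mono)
  qed
qed

end
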